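(* Suppose that the following hold (notation in the context). (No anticipation) For all $g$, $t<T$ and $(d_1,\dots,d_T)\in\mathcal{D}$, $Y_{g,t}(d_1,\dots,d_T)$ does not depend on $(d_{t+1},\dots,d_T)$; it is denoted $Y_{g,t}(d_1,\dots,d_t)$. (i.i.d. groups) The variables $\big((Y_{g,1}(d_1),\dots,Y_{g,T}(d_1,\dots,d_T))_{(d_1,\dots,d_T)\in\mathcal{D}},\bm{D}_g\big)_{g\ge 1}$ are i.i.d. (Designs with some stayers) $\mathcal{D}^{\mathrm{r}}_1:=\{d\in\mathcal{D}_1: V(F\mid D_1=d)>0\}\neq\emptyset$. (Parallel trends for the status-quo outcome, conditional on the period-one treatment) If $D_1\in\mathcal{D}^{\mathrm{r}}_1$, then for all $t\ge 2$, $$E[Y_t(D_1,\dots,D_1)-Y_{t-1}(D_1,\dots,D_1)\mid\bm{D}]=E[Y_t(D_1,\dots,D_1)-Y_{t-1}(D_1,\dots,D_1)\mid D_1].$$ Let $\ell\in\{1,\dots,T-1\}$ be such that $P(\bm{D}\in\mathcal{D}^\ell)>0$. Then $$\mathrm{AVSQ}_\ell:=E\left[S\times\big(Y_{F-1+\ell}-Y_{F-1+\ell}(D_1,\dots,D_1)\big)\,\middle|\,\bm{D}\in\mathcal{D}^\ell\right]$$ is identified, i.e., it is determined by the joint distribution of the observables $(Y_1,\dots,Y_T,\bm{D})$. Moreover, $$\mathrm{AVSQ}_\ell=E\left[S\times\big(Y_{F-1+\ell}-Y_{F-1}-\Delta_\ell(D_1,F)\big)\,\middle|\,\bm{D}\in\mathcal{D}^\ell\right],$$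 where $\Delta_\ell(d_1,f)=E[Y_{f-1+\ell}-Y_{f-1}\mid D_1=d_1,\,F>f-1+\ell]$. Finally, $P(\bm{D}\in\mathcal{D}^\ell)>0$ holds for at least $\ell=1$.
   Context: Setting. A panel of groups $g$ is observed at periods $t=1,\dots,T$. $D_{g,t}$ is the (real-valued, not necessarily binary) treatment of group $g$ at period $t$, with support $\mathcal{D}_t$ (not depending on $g$); $\bm{D}_g=(D_{g,1},\dots,D_{g,T})$ is its treatment path, with support $\mathcal{D}$ (not depending on $g$). $Y_{g,t}(d_1,\dots,d_T)$ is the potential outcome of group $g$ at period $t$ under treatment path $(d_1,\dots,d_T)$. The observed outcome is $Y_{g,t}=Y_{g,t}(D_{g,1},\dots,D_{g,t})$. Since groups are identically distributed, the index $g$ is omitted. $Y_t(D_1,\dots,D_1)$ denotes the status-quo potential outcome at $t$, obtained when the treatment is kept equal to its period-one value $D_1$ from period 1 to $t$. Potential outcomes are understood to be defined for every treatment sequence appearing in the statement, and all expectations written are understood to be well defined. First switching date: $F=\min\{t\ge 2: D_t\neq D_1\}$, with $F=T+1$ if the treatment never changes. $S=\mathrm{sgn}(D_F-D_1)$ if $F\le T$, and $S=0$ otherwise. For $d\in\mathcal{D}_1$, $\overline{T}_d:=\max\mathrm{Supp}(F-1\mid D_1=d)$. No-crossing paths until $t$: $$\mathcal{D}^{\mathrm{nc}}_t:=\Big\{(d_1,\dots,d_T)\in\mathcal{D}:\ \text{either } \min_{1<s\le t}d_s\ge d_1\ \text{ or }\ \max_{1<s\le t}d_s\le d_1\Big\}.$$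 For $\ell\ge1$, $$\mathcal{D}^\ell:=\Big\{(d_1,\dots,d_T)\in\mathcal{D}:\ d_1\in\mathcal{D}^{\mathrm{r}}_1,\ f-1+\ell\le\overline{T}_{d_1},\ (d_1,\dots,d_T)\in\mathcal{D}^{\mathrm{nc}}_{f-1+\ell}\Big\},\quad f:=\min\{t>1:d_t\neq d_1\}$$ (with $f=T+1$ if no such $t$ exists, in which case the path is not in $\mathcal{D}^\ell$ because $\overline{T}_{d_1}\le T$). If the distribution of $D_1$ is continuous, it is assumed that there is a continuous version of $d\mapsto V(F\mid D_1=d)$, and this version is used in the definition of $\mathcal{D}^{\mathrm{r}}_1$. *)

theory Defs
  imports "HOL-Probability.Probability"
begin

text \<open>
  Support of a random variable: the set of its atoms if it is discrete, and the topological
  support otherwise.  (For a discrete variable the topological support may contain values of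
  probability zero, given which nothing can be conditioned on.)
\<close>
definition rv_support :: "'w measure \<Rightarrow> ('w \<Rightarrow> 'v::topological_space) \<Rightarrow> 'v set" where
  "rv_support M X =
     (if \<exists>C. countable C \<and> (AE \<omega> in M. X \<omega> \<in> C)
      then {x. measure M {\<omega> \<in> space M. X \<omega> = x} > 0}
      else {x. \<forall>U. open U \<and> x \<in> U \<longrightarrow> measure M {\<omega> \<in> space M. X \<omega> \<in> U} > 0})"

text \<open>\<open>h\<close> is, on \<open>B\<close>, a version of \<open>z \<mapsto> E[X | Z = z]\<close>.\<close>
definition cond_exp_version ::
  "'w measure \<Rightarrow> ('w \<Rightarrow> real) \<Rightarrow> ('w \<Rightarrow> real) \<Rightarrow> real set \<Rightarrow> (real \<Rightarrow> real) \<Rightarrow> bool" where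
  "cond_exp_version M X Z B h \<longleftrightarrow>
     h \<in> borel_measurable borel \<and>
     (AE \<omega> in M. Z \<omega> \<in> B \<longrightarrow>
        real_cond_exp M (vimage_algebra (space M) Z borel) X \<omega> = h (Z \<omega>))"

text \<open>\<open>E[X | A]\<close> for an event \<open>A\<close> of positive probability.\<close>
definition event_exp :: "'w measure \<Rightarrow> ('w \<Rightarrow> real) \<Rightarrow> 'w set \<Rightarrow> real" where
  "event_exp M X A = (LINT \<omega>:A|M. X \<omega>) / measure M A"

text \<open>
  \<open>D t \<omega>\<close> is the treatment at period \<open>t\<close>, for \<open>t \<in> {1..T}\<close>.  A treatment sequence of length \<open>t\<close>
  is a function restricted to \<open>{1..t}\<close>, i.e. an element of \<open>extensional {1..t}\<close>.
\<close>
type_synonym treatment_seq = "nat \<Rightarrow> real"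

definition treatment_path :: "nat \<Rightarrow> (nat \<Rightarrow> 'w \<Rightarrow> real) \<Rightarrow> 'w \<Rightarrow> treatment_seq" where
  "treatment_path T D \<omega> = (\<lambda>t\<in>{1..T}. D t \<omega>)"

abbreviation seq_algebra :: "nat \<Rightarrow> (nat \<Rightarrow> real) measure" where
  "seq_algebra T \<equiv> PiM {1..T} (\<lambda>_. borel)"

definition first_switch :: "nat \<Rightarrow> treatment_seq \<Rightarrow> nat" where
  "first_switch T d =
     (if \<exists>t\<in>{2..T}. d t \<noteq> d 1 then Min {t\<in>{2..T}. d t \<noteq> d 1} else T + 1)"

definition switch_date :: "nat \<Rightarrow> (nat \<Rightarrow> 'w \<Rightarrow> real) \<Rightarrow> 'w \<Rightarrow> nat" where
  "switch_date T D \<omega> = first_switch T (treatment_path T D \<omega>)"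

definition switch_sign :: "nat \<Rightarrow> (nat \<Rightarrow> 'w \<Rightarrow> real) \<Rightarrow> 'w \<Rightarrow> real" where
  "switch_sign T D \<omega> =
     (if switch_date T D \<omega> \<le> T then sgn (D (switch_date T D \<omega>) \<omega> - D 1 \<omega>) else 0)"

text \<open>
  \<open>\<kappa> d\<close> is the conditional distribution of \<open>F\<close> given \<open>D\<^sub>1 = d\<close>: for every \<open>f\<close>,
  \<open>d \<mapsto> \<kappa> d {f}\<close> is a version of \<open>d \<mapsto> P(F = f | D\<^sub>1 = d)\<close>.
\<close>
definition cond_dist_switch ::
  "'w measure \<Rightarrow> nat \<Rightarrow> (nat \<Rightarrow> 'w \<Rightarrow> real) \<Rightarrow> (real \<Rightarrow> nat pmf) \<Rightarrow> bool" where
  "cond_dist_switch M T D \<kappa> \<longleftrightarrow>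
     (\<forall>d\<in>rv_support M (D 1). set_pmf (\<kappa> d) \<subseteq> {2..T + 1}) \<and>
     (\<forall>f. cond_exp_version M (indicator {\<omega> \<in> space M. switch_date T D \<omega> = f}) (D 1) UNIV
            (\<lambda>d. pmf (\<kappa> d) f))"

definition cond_var_switch :: "(real \<Rightarrow> nat pmf) \<Rightarrow> real \<Rightarrow> real" where
  "cond_var_switch \<kappa> d = measure_pmf.variance (\<kappa> d) real"

text \<open>
  Continuity of the chosen version of \<open>d \<mapsto> V(F | D\<^sub>1 = d)\<close> at the points of the support that are
  not atoms of \<open>D\<^sub>1\<close>.  If \<open>D\<^sub>1\<close> is continuous, this is continuity on the whole support; if \<open>D\<^sub>1\<close> is
  discrete, the condition is void.
\<close>
definition cond_var_continuous ::
  "'w measure \<Rightarrow> (nat \<Rightarrow> 'w \<Rightarrow> real) \<Rightarrow> (real \<Rightarrow> nat pmf) \<Rightarrow> bool" where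
  "cond_var_continuous M D \<kappa> \<longleftrightarrow>
     (\<forall>d\<in>rv_support M (D 1). measure M {\<omega> \<in> space M. D 1 \<omega> = d} = 0 \<longrightarrow>
        continuous (at d within rv_support M (D 1)) (cond_var_switch \<kappa>))"

definition relevant_baseline ::
  "'w measure \<Rightarrow> (nat \<Rightarrow> 'w \<Rightarrow> real) \<Rightarrow> (real \<Rightarrow> nat pmf) \<Rightarrow> real set" where
  "relevant_baseline M D \<kappa> = {d \<in> rv_support M (D 1). cond_var_switch \<kappa> d > 0}"

definition T_bar :: "(real \<Rightarrow> nat pmf) \<Rightarrow> real \<Rightarrow> nat" where
  "T_bar \<kappa> d = Max ((\<lambda>f. f - 1) ` set_pmf (\<kappa> d))"

text \<open>Only used for \<open>t \<ge> 2\<close>, where the set \<open>{1<..t}\<close> is nonempty.\<close>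
definition no_crossing_paths ::
  "'w measure \<Rightarrow> nat \<Rightarrow> (nat \<Rightarrow> 'w \<Rightarrow> real) \<Rightarrow> nat \<Rightarrow> treatment_seq set" where
  "no_crossing_paths M T D t =
     {d \<in> rv_support M (treatment_path T D).
        Min (d ` {1<..t}) \<ge> d 1 \<or> Max (d ` {1<..t}) \<le> d 1}"

definition effect_paths ::
  "'w measure \<Rightarrow> nat \<Rightarrow> (nat \<Rightarrow> 'w \<Rightarrow> real) \<Rightarrow> (real \<Rightarrow> nat pmf) \<Rightarrow> nat \<Rightarrow> treatment_seq set" where
  "effect_paths M T D \<kappa> l =
     {d \<in> rv_support M (treatment_path T D).
        d 1 \<in> relevant_baseline M D \<kappa> \<and>
        first_switch T d - 1 + l \<le> T_bar \<kappa> (d 1) \<and>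
        d \<in> no_crossing_paths M T D (first_switch T d - 1 + l)}"

definition effect_event ::
  "'w measure \<Rightarrow> nat \<Rightarrow> (nat \<Rightarrow> 'w \<Rightarrow> real) \<Rightarrow> (real \<Rightarrow> nat pmf) \<Rightarrow> nat \<Rightarrow> 'w set" where
  "effect_event M T D \<kappa> l =
     {\<omega> \<in> space M. treatment_path T D \<omega> \<in> effect_paths M T D \<kappa> l}"

text \<open>
  \<open>Yfull g t d\<close> is the potential outcome of group \<open>g\<close> at period \<open>t\<close> under the full path \<open>d\<close>, and
  \<open>Y g t d\<close> with \<open>d \<in> extensional {1..t}\<close> is the notation \<open>Y\<^sub>g\<^sub>,\<^sub>t(d\<^sub>1,\<dots>,d\<^sub>t)\<close> that
  no anticipation justifies.  \<open>Y\<close> is total, so that \<open>Y\<^sub>g\<^sub>,\<^sub>t(d\<^sub>1,\<dots>,d\<^sub>1)\<close> is also defined when no path in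
  the support starts in this way; no anticipation does not constrain it there.
\<close>
definition no_anticipation ::
  "'w measure \<Rightarrow> nat \<Rightarrow> treatment_seq set
   \<Rightarrow> (nat \<Rightarrow> nat \<Rightarrow> treatment_seq \<Rightarrow> 'w \<Rightarrow> real)
   \<Rightarrow> (nat \<Rightarrow> nat \<Rightarrow> treatment_seq \<Rightarrow> 'w \<Rightarrow> real) \<Rightarrow> bool" where
  "no_anticipation M T \<D> Yfull Y \<longleftrightarrow>
     (\<forall>g\<ge>1. \<forall>t\<in>{1..T}. \<forall>d\<in>\<D>. \<forall>\<omega>\<in>space M. Yfull g t d \<omega> = Y g t (restrict d {1..t}) \<omega>)"

definition group_algebra :: "nat \<Rightarrow> treatment_seq set
    \<Rightarrow> ((nat \<times> treatment_seq \<Rightarrow> real) \<times> (nat \<Rightarrow> real)) measure" where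
  "group_algebra T \<D> = PiM ({1..T} \<times> \<D>) (\<lambda>_. borel) \<Otimes>\<^sub>M seq_algebra T"

definition group_vector ::
  "nat \<Rightarrow> treatment_seq set \<Rightarrow> (nat \<Rightarrow> treatment_seq \<Rightarrow> 'w \<Rightarrow> real) \<Rightarrow> (nat \<Rightarrow> 'w \<Rightarrow> real)
   \<Rightarrow> 'w \<Rightarrow> (nat \<times> treatment_seq \<Rightarrow> real) \<times> (nat \<Rightarrow> real)" where
  "group_vector T \<D> Y D \<omega> =
     ((\<lambda>(t, d)\<in>{1..T} \<times> \<D>. Y t (restrict d {1..t}) \<omega>), treatment_path T D \<omega>)"

definition iid_groups ::
  "'w measure \<Rightarrow> nat \<Rightarrow> treatment_seq set
   \<Rightarrow> (nat \<Rightarrow> nat \<Rightarrow> treatment_seq \<Rightarrow> 'w \<Rightarrow> real) \<Rightarrow> (nat \<Rightarrow> nat \<Rightarrow> 'w \<Rightarrow> real) \<Rightarrow> bool" where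
  "iid_groups M T \<D> Y D \<longleftrightarrow>
     prob_space.indep_vars M (\<lambda>_. group_algebra T \<D>) (\<lambda>g. group_vector T \<D> (Y g) (D g)) {1..} \<and>
     (\<forall>g\<ge>1. distr M (group_algebra T \<D>) (group_vector T \<D> (Y g) (D g)) =
             distr M (group_algebra T \<D>) (group_vector T \<D> (Y 1) (D 1)))"

text \<open>
  From here on \<open>Y\<close> and \<open>D\<close> are those of a single group.
\<close>
definition observed ::
  "(nat \<Rightarrow> treatment_seq \<Rightarrow> 'w \<Rightarrow> real) \<Rightarrow> (nat \<Rightarrow> 'w \<Rightarrow> real) \<Rightarrow> nat \<Rightarrow> 'w \<Rightarrow> real" where
  "observed Y D t \<omega> = Y t (\<lambda>s\<in>{1..t}. D s \<omega>) \<omega>"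

definition status_quo ::
  "(nat \<Rightarrow> treatment_seq \<Rightarrow> 'w \<Rightarrow> real) \<Rightarrow> (nat \<Rightarrow> 'w \<Rightarrow> real) \<Rightarrow> nat \<Rightarrow> 'w \<Rightarrow> real" where
  "status_quo Y D t \<omega> = Y t (\<lambda>s\<in>{1..t}. D 1 \<omega>) \<omega>"

definition observables ::
  "nat \<Rightarrow> (nat \<Rightarrow> treatment_seq \<Rightarrow> 'w \<Rightarrow> real) \<Rightarrow> (nat \<Rightarrow> 'w \<Rightarrow> real)
   \<Rightarrow> 'w \<Rightarrow> (nat \<Rightarrow> real) \<times> (nat \<Rightarrow> real)" where
  "observables T Y D \<omega> = ((\<lambda>t\<in>{1..T}. observed Y D t \<omega>), treatment_path T D \<omega>)"

definition observables_dist ::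
  "'w measure \<Rightarrow> nat \<Rightarrow> (nat \<Rightarrow> treatment_seq \<Rightarrow> 'w \<Rightarrow> real) \<Rightarrow> (nat \<Rightarrow> 'w \<Rightarrow> real)
   \<Rightarrow> ((nat \<Rightarrow> real) \<times> (nat \<Rightarrow> real)) measure" where
  "observables_dist M T Y D =
     distr M (seq_algebra T \<Otimes>\<^sub>M seq_algebra T) (observables T Y D)"

definition outcomes_measurable ::
  "'w measure \<Rightarrow> nat \<Rightarrow> (nat \<Rightarrow> treatment_seq \<Rightarrow> 'w \<Rightarrow> real) \<Rightarrow> (nat \<Rightarrow> 'w \<Rightarrow> real) \<Rightarrow> bool" where
  "outcomes_measurable M T Y D \<longleftrightarrow>
     (\<forall>t\<in>{1..T}. observed Y D t \<in> borel_measurable M \<and> status_quo Y D t \<in> borel_measurable M)"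

definition parallel_trends ::
  "'w measure \<Rightarrow> nat \<Rightarrow> (nat \<Rightarrow> treatment_seq \<Rightarrow> 'w \<Rightarrow> real) \<Rightarrow> (nat \<Rightarrow> 'w \<Rightarrow> real)
   \<Rightarrow> (real \<Rightarrow> nat pmf) \<Rightarrow> bool" where
  "parallel_trends M T Y D \<kappa> \<longleftrightarrow>
     (\<forall>t\<in>{2..T}. let X = (\<lambda>\<omega>. status_quo Y D t \<omega> - status_quo Y D (t - 1) \<omega>) in
        set_integrable M {\<omega> \<in> space M. D 1 \<omega> \<in> relevant_baseline M D \<kappa>} X \<and>
        (AE \<omega> in M. D 1 \<omega> \<in> relevant_baseline M D \<kappa> \<longrightarrow>
           real_cond_exp M (vimage_algebra (space M) (treatment_path T D) (seq_algebra T)) X \<omega> =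
           real_cond_exp M (vimage_algebra (space M) (D 1) borel) X \<omega>))"

text \<open>
  By identical distribution, all groups have the same path support, here that of group 1.
\<close>
definition panel_model ::
  "'w measure \<Rightarrow> nat \<Rightarrow> (nat \<Rightarrow> nat \<Rightarrow> treatment_seq \<Rightarrow> 'w \<Rightarrow> real)
   \<Rightarrow> (nat \<Rightarrow> nat \<Rightarrow> treatment_seq \<Rightarrow> 'w \<Rightarrow> real) \<Rightarrow> (nat \<Rightarrow> nat \<Rightarrow> 'w \<Rightarrow> real) \<Rightarrow> bool" where
  "panel_model M T Yfull Y D \<longleftrightarrow>
     prob_space M \<and>
     no_anticipation M T (rv_support M (treatment_path T (D 1))) Yfull Y \<and>
     iid_groups M T (rv_support M (treatment_path T (D 1))) Y D"

definition group_model ::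
  "'w measure \<Rightarrow> nat \<Rightarrow> (nat \<Rightarrow> treatment_seq \<Rightarrow> 'w \<Rightarrow> real) \<Rightarrow> (nat \<Rightarrow> 'w \<Rightarrow> real)
   \<Rightarrow> (real \<Rightarrow> nat pmf) \<Rightarrow> bool" where
  "group_model M T Y D \<kappa> \<longleftrightarrow>
     outcomes_measurable M T Y D \<and>
     cond_dist_switch M T D \<kappa> \<and>
     cond_var_continuous M D \<kappa> \<and>
     relevant_baseline M D \<kappa> \<noteq> {} \<and>
     parallel_trends M T Y D \<kappa>"

definition avsq_integrand ::
  "nat \<Rightarrow> (nat \<Rightarrow> treatment_seq \<Rightarrow> 'w \<Rightarrow> real) \<Rightarrow> (nat \<Rightarrow> 'w \<Rightarrow> real) \<Rightarrow> nat \<Rightarrow> 'w \<Rightarrow> real" where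
  "avsq_integrand T Y D l \<omega> =
     switch_sign T D \<omega> *
       (observed Y D (switch_date T D \<omega> - 1 + l) \<omega> - status_quo Y D (switch_date T D \<omega> - 1 + l) \<omega>)"

definition AVSQ_well_defined ::
  "'w measure \<Rightarrow> nat \<Rightarrow> (nat \<Rightarrow> treatment_seq \<Rightarrow> 'w \<Rightarrow> real) \<Rightarrow> (nat \<Rightarrow> 'w \<Rightarrow> real)
   \<Rightarrow> (real \<Rightarrow> nat pmf) \<Rightarrow> nat \<Rightarrow> bool" where
  "AVSQ_well_defined M T Y D \<kappa> l \<longleftrightarrow>
     set_integrable M (effect_event M T D \<kappa> l) (avsq_integrand T Y D l)"

definition AVSQ ::
  "'w measure \<Rightarrow> nat \<Rightarrow> (nat \<Rightarrow> treatment_seq \<Rightarrow> 'w \<Rightarrow> real) \<Rightarrow> (nat \<Rightarrow> 'w \<Rightarrow> real)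
   \<Rightarrow> (real \<Rightarrow> nat pmf) \<Rightarrow> nat \<Rightarrow> real" where
  "AVSQ M T Y D \<kappa> l = event_exp M (avsq_integrand T Y D l) (effect_event M T D \<kappa> l)"

text \<open>
  \<open>\<Delta>\<close> is a version of \<open>\<Delta>\<^sub>l(d, f) = E[Y\<^sub>f\<^sub>-\<^sub>1\<^sub>+\<^sub>l - Y\<^sub>f\<^sub>-\<^sub>1 | D\<^sub>1 = d, F > f - 1 + l]\<close>
  for relevant \<open>d\<close>: conditioning on the event \<open>F > f - 1 + l\<close> is done by passing to the
  corresponding conditional probability measure.
\<close>
definition status_quo_trend ::
  "'w measure \<Rightarrow> nat \<Rightarrow> (nat \<Rightarrow> treatment_seq \<Rightarrow> 'w \<Rightarrow> real) \<Rightarrow> (nat \<Rightarrow> 'w \<Rightarrow> real)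
   \<Rightarrow> (real \<Rightarrow> nat pmf) \<Rightarrow> nat \<Rightarrow> (real \<Rightarrow> nat \<Rightarrow> real) \<Rightarrow> bool" where
  "status_quo_trend M T Y D \<kappa> l \<Delta> \<longleftrightarrow>
     (\<forall>f. 2 \<le> f \<and> f - 1 + l \<le> T \<longrightarrow>
        cond_exp_version
          (uniform_measure M {\<omega> \<in> space M. switch_date T D \<omega> > f - 1 + l})
          (\<lambda>\<omega>. observed Y D (f - 1 + l) \<omega> - observed Y D (f - 1) \<omega>)
          (D 1) (relevant_baseline M D \<kappa>) (\<lambda>d. \<Delta> d f))"

end

theory Submission
  imports Defs
begin

text \<open>
  On the event \<open>F > t\<close> the observed outcome at \<open>t\<close> is the status-quo outcome, so the observed trend
  of the groups that have not yet switched is a status-quo trend.  Parallel trends, summed over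
  periods, say that the conditional expectation of the status-quo trend given the whole path is a
  function \<open>h(D\<^sub>1)\<close>; conditioning on \<open>D\<^sub>1\<close> and \<open>F > t\<close> therefore also gives \<open>h(D\<^sub>1)\<close>.  On the effect
  event, \<open>F - 1 + l \<le> T_bar\<close> makes \<open>F > t\<close> possible given \<open>D\<^sub>1\<close>, so \<open>h(D\<^sub>1)\<close> is pinned down there by the
  observables.  Since the sign, the event and \<open>D\<^sub>1\<close> are functions of the path, replacing the
  status-quo trend by \<open>h(D\<^sub>1)\<close> does not change the integral.

  For \<open>l = 1\<close>: if almost no group were in the effect event, then given a relevant \<open>D\<^sub>1\<close> no switching
  date below another possible one could occur, so \<open>F\<close> would be constant given \<open>D\<^sub>1\<close>, contradicting
  its positive variance.  Relevant \<open>D\<^sub>1\<close> have positive probability, at a non-atom by continuity of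
  the conditional variance.
\<close>

section \<open>Conditional expectations and supports\<close>

text \<open>Increments of the status-quo outcome are assumed integrable only over relevant
  baselines, so their conditional expectations are computed after cutting to that set. A trend
  function is then recorded by integral identities against all bounded weights measurable in the
  path: in this form trends over consecutive periods add up, the events \<open>F > t\<close> and
  \<open>F = f\<close> are admissible weights, and identities between observable quantities can be
  carried to another probability space. The identification does not start from a given version of
  \<open>\<Delta>\<close>: the trend function of one model serves as \<open>\<Delta>\<close> in
  both. The obstacle there is the kernel \<open>\<kappa>\<close>: it belongs to the model and the
  data fix it only up to null sets of \<open>D 1\<close>, yet \<open>T_bar\<close> and the relevant
  baselines read it pointwise. Two models are therefore first brought to a common kernel, after
  which their effect paths are the same set.\<close>

lemma real_cond_exp_indicator_mult:
  assumes "sigma_finite_subalgebra M F" "A \<in> sets F" "X \<in> borel_measurable M"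
  shows "AE x in M. real_cond_exp M F (\<lambda>x. indicator A x * X x) x = indicator A x * real_cond_exp M F X x"
proof -
  interpret sigma_finite_subalgebra M F by fact
  note [measurable] = assms(2,3)
  \<comment> \<open>A factor with values 0 and 1 passes through the positive and the negative part
    of \<open>X\<close> separately, where only nonnegative conditional expectations occur;
    integrability is then no issue.\<close>
  have pos: "(\<lambda>x. ennreal (indicator A x * X x)) = (\<lambda>x. indicator A x * ennreal (X x))"
    and neg: "(\<lambda>x. ennreal (- (indicator A x * X x))) = (\<lambda>x. indicator A x * ennreal (- X x))"
    by (auto split: split_indicator)
  have "AE x in M. indicator A x * nn_cond_exp M F (\<lambda>x. ennreal (X x)) x =
          nn_cond_exp M F (\<lambda>x. indicator A x * ennreal (X x)) x"
    "AE x in M. indicator A x * nn_cond_exp M F (\<lambda>x. ennreal (- X x)) x =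
          nn_cond_exp M F (\<lambda>x. indicator A x * ennreal (- X x)) x"
    by (auto intro!: nn_cond_exp_prod)
  then show ?thesis
    unfolding real_cond_exp_def pos neg by eventually_elim (auto simp flip: split: split_indicator)
qed

text \<open>Doob-Dynkin factorization. A simple function factors because each of its level sets is a
  preimage under \<open>Z\<close>; pointwise limits give the general case. Off the range of
  \<open>Z\<close> the factors may diverge, but \<open>lim\<close> still defines a measurable
  function.\<close>

lemma borel_measurable_vimage_algebra_factor:
  fixes f :: "'a \<Rightarrow> real"
  assumes Z: "Z \<in> \<Omega> \<rightarrow> space N" and f: "f \<in> borel_measurable (vimage_algebra \<Omega> Z N)"
  obtains h where "h \<in> borel_measurable N" "\<And>\<omega>. \<omega> \<in> \<Omega> \<Longrightarrow> f \<omega> = h (Z \<omega>)"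
proof -
  let ?V = "vimage_algebra \<Omega> Z N"
  obtain s where s: "\<And>i. simple_function ?V (s i)"
      and lim: "\<And>\<omega>. \<omega> \<in> space ?V \<Longrightarrow> (\<lambda>i. s i \<omega>) \<longlonglongrightarrow> f \<omega>"
    using borel_measurable_implies_sequence_metric[OF f, of 0] by blast
  have "\<exists>h. h \<in> borel_measurable N \<and> (\<forall>\<omega>\<in>\<Omega>. s i \<omega> = h (Z \<omega>))" for i
  proof -
    have "\<forall>y\<in>s i ` \<Omega>. \<exists>A. A \<in> sets N \<and> s i -` {y} \<inter> \<Omega> = Z -` A \<inter> \<Omega>"
    proof
      fix y assume "y \<in> s i ` \<Omega>"
      have "s i -` {y} \<inter> \<Omega> \<in> sets ?V"
        using simple_functionD(2)[OF s[of i], of "{y}"] by simp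
      then show "\<exists>A. A \<in> sets N \<and> s i -` {y} \<inter> \<Omega> = Z -` A \<inter> \<Omega>"
        using Z by (auto simp: sets_vimage_algebra2)
    qed
    then obtain A where A: "\<And>y. y \<in> s i ` \<Omega> \<Longrightarrow> A y \<in> sets N"
      "\<And>y. y \<in> s i ` \<Omega> \<Longrightarrow> s i -` {y} \<inter> \<Omega> = Z -` A y \<inter> \<Omega>"
      by metis
    define h where "h x = (\<Sum>y\<in>s i ` \<Omega>. y * indicator (A y) x)" for x
    have fin: "finite (s i ` \<Omega>)"
      using simple_functionD(1)[OF s[of i]] by simp
    have "h \<in> borel_measurable N"
      unfolding h_def using A(1) by measurable
    moreover have "s i \<omega> = h (Z \<omega>)" if "\<omega> \<in> \<Omega>" for \<omega>
    proof -
      have "h (Z \<omega>) = (\<Sum>y\<in>s i ` \<Omega>. if y = s i \<omega> then y else 0)"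
        unfolding h_def
      proof (rule sum.cong)
        fix y assume "y \<in> s i ` \<Omega>"
        then have "\<omega> \<in> s i -` {y} \<inter> \<Omega> \<longleftrightarrow> \<omega> \<in> Z -` A y \<inter> \<Omega>"
          using A(2) by simp
        then have "Z \<omega> \<in> A y \<longleftrightarrow> y = s i \<omega>"
          using that by auto
        then show "y * indicator (A y) (Z \<omega>) = (if y = s i \<omega> then y else 0)"
          by (auto simp: indicator_def)
      qed simp
      then show ?thesis
        using that fin by simp
    qed
    ultimately show ?thesis by blast
  qed
  then obtain h where h: "\<And>i. h i \<in> borel_measurable N" "\<And>i \<omega>. \<omega> \<in> \<Omega> \<Longrightarrow> s i \<omega> = h i (Z \<omega>)"
    by metis
  show ?thesis
  proof
    show "(\<lambda>x. lim (\<lambda>i. h i x)) \<in> borel_measurable N"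
      using h(1) by (rule borel_measurable_lim_metric)
    show "f \<omega> = lim (\<lambda>i. h i (Z \<omega>))" if "\<omega> \<in> \<Omega>" for \<omega>
      using lim[of \<omega>] h(2)[OF that] that by (simp add: limI)
  qed
qed

lemma AE_nonpos_if_integral_positive_part_eq_0:
  fixes w :: "'a \<Rightarrow> real"
  assumes w: "integrable M w" and 0: "(LINT x|M. indicator {x. w x > 0} x * w x) = 0"
  shows "AE x in M. w x \<le> 0"
proof -
  have [measurable]: "w \<in> borel_measurable M" using w by simp
  have "integrable M (\<lambda>x. indicator {x. w x > 0} x * w x)"
    using w by (rule Bochner_Integration.integrable_bound) (auto split: split_indicator)
  then have "AE x in M. indicator {x. w x > 0} x * w x = 0"
    using 0 by (subst (asm) integral_nonneg_eq_0_iff_AE) (auto split: split_indicator)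
  then show ?thesis
    by eventually_elim (auto split: split_indicator_asm)
qed

section \<open>Supports of random variables\<close>

lemma rv_support_borel:
  fixes X :: "'w \<Rightarrow> 'v::{second_countable_topology, t1_space}"
  shows "rv_support M X \<in> sets borel"
proof (cases "\<exists>C. countable C \<and> (AE \<omega> in M. X \<omega> \<in> C)")
  case True
  then obtain C where C: "countable C" "AE \<omega> in M. X \<omega> \<in> C" by blast
  have "x \<in> C" if x: "measure M {\<omega> \<in> space M. X \<omega> = x} > 0" for x
  proof (rule ccontr)
    assume "x \<notin> C"
    have "AE \<omega> in M. \<omega> \<notin> {\<omega> \<in> space M. X \<omega> = x}"
      using C(2) by eventually_elim (use \<open>x \<notin> C\<close> in auto)
    moreover have "{\<omega> \<in> space M. X \<omega> = x} \<in> sets M"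
      using x measure_notin_sets by force
    ultimately have "measure M {\<omega> \<in> space M. X \<omega> = x} = 0"
      by (simp add: AE_iff_null_sets null_setsD1 measure_def)
    with x show False by simp
  qed
  then have "rv_support M X \<subseteq> C"
    using True by (auto simp: rv_support_def)
  then have "countable (rv_support M X)"
    using C(1) countable_subset by blast
  then show ?thesis
    by (rule sets.countable[rotated]) auto
next
  case False
  let ?\<U> = "{U. open U \<and> \<not> measure M {\<omega> \<in> space M. X \<omega> \<in> U} > 0}"
  have "rv_support M X = - \<Union>?\<U>"
    using False unfolding rv_support_def by auto
  moreover have "open (\<Union>?\<U>)"
    by auto
  ultimately show ?thesis
    by (simp add: borel_closed closed_Compl)
qed

text \<open>A point outside the support is a null value or lies in a null open set. These are
  reduced to countably many by the carrier \<open>C\<close> in the discrete case and by a countable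
  basis otherwise.\<close>

lemma (in prob_space) AE_in_rv_support:
  fixes X :: "'a \<Rightarrow> 'v::{second_countable_topology, t1_space}"
  assumes [measurable]: "X \<in> borel_measurable M"
  shows "AE \<omega> in M. X \<omega> \<in> rv_support M X"
proof (cases "\<exists>C. countable C \<and> (AE \<omega> in M. X \<omega> \<in> C)")
  case True
  then obtain C where C: "countable C" "AE \<omega> in M. X \<omega> \<in> C" by blast
  have "AE \<omega> in M. \<forall>c\<in>C. prob {\<omega> \<in> space M. X \<omega> = c} = 0 \<longrightarrow> X \<omega> \<noteq> c"
    unfolding AE_ball_countable[OF C(1)]
  proof
    fix c assume "c \<in> C"
    show "AE \<omega> in M. prob {\<omega> \<in> space M. X \<omega> = c} = 0 \<longrightarrow> X \<omega> \<noteq> c"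
    proof (cases "prob {\<omega> \<in> space M. X \<omega> = c} = 0")
      case True
      then show ?thesis by (subst (asm) prob_eq_0) auto
    qed auto
  qed
  with C(2) have "AE \<omega> in M. prob {\<omega>' \<in> space M. X \<omega>' = X \<omega>} > 0"
    by eventually_elim (auto simp: less_le)
  then show ?thesis
    using True by (simp add: rv_support_def)
next
  case False
  obtain B :: "'v set set" where B: "countable B" "topological_basis B"
    using ex_countable_basis by blast
  have "AE \<omega> in M. \<forall>U\<in>B. prob {\<omega> \<in> space M. X \<omega> \<in> U} = 0 \<longrightarrow> X \<omega> \<notin> U"
    unfolding AE_ball_countable[OF B(1)]
  proof
    fix U assume "U \<in> B"
    then have "open U" using B(2) topological_basis_open by blast
    then have [measurable]: "U \<in> sets borel" by simp
    show "AE \<omega> in M. prob {\<omega> \<in> space M. X \<omega> \<in> U} = 0 \<longrightarrow> X \<omega> \<notin> U"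
    proof (cases "prob {\<omega> \<in> space M. X \<omega> \<in> U} = 0")
      case True
      then show ?thesis by (subst (asm) prob_eq_0) auto
    qed auto
  qed
  then show ?thesis
  proof eventually_elim
    case (elim \<omega>)
    have "prob {\<omega>' \<in> space M. X \<omega>' \<in> U} > 0" if U: "open U" "X \<omega> \<in> U" for U
    proof -
      obtain V where V: "V \<in> B" "X \<omega> \<in> V" "V \<subseteq> U"
        using topological_basisE[OF B(2) U] .
      have [measurable]: "V \<in> sets borel" "U \<in> sets borel"
        using V(1) B(2) U(1) by (auto intro: borel_open topological_basis_open)
      have "prob {\<omega>' \<in> space M. X \<omega>' \<in> V} > 0"
        using elim V by (auto simp: less_le)
      also have "prob {\<omega>' \<in> space M. X \<omega>' \<in> V} \<le> prob {\<omega>' \<in> space M. X \<omega>' \<in> U}"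
        using V(3) by (intro finite_measure_mono) auto
      finally show ?thesis .
    qed
    then show ?case
      using False by (auto simp: rv_support_def)
  qed
qed

lemma rv_support_cong_distr:
  fixes X :: "'w \<Rightarrow> 'v::{second_countable_topology, t1_space}"
  assumes [measurable]: "X \<in> borel_measurable M" "X' \<in> borel_measurable M'"
    and eq: "distr M borel X = distr M' borel X'"
  shows "rv_support M X = rv_support M' X'"
proof -
  have m: "measure M {\<omega> \<in> space M. X \<omega> \<in> A} = measure M' {\<omega> \<in> space M'. X' \<omega> \<in> A}"
    if "A \<in> sets borel" for A
    using arg_cong[OF eq, of "\<lambda>N. measure N A"] that
    by (simp add: measure_distr vimage_def Int_def conj_commute)
  \<comment> \<open>The case distinction inside \<open>rv_support\<close> has to be transferred too;
    countable sets are Borel because points are closed.\<close>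
  have ae: "(AE \<omega> in M. X \<omega> \<in> C) \<longleftrightarrow> (AE \<omega> in M'. X' \<omega> \<in> C)" if "countable C" for C
  proof -
    have [measurable]: "C \<in> sets borel" using that by (rule sets.countable[rotated]) auto
    have "(AE \<omega> in M. X \<omega> \<in> C) \<longleftrightarrow> (AE x in distr M borel X. x \<in> C)"
      by (subst AE_distr_iff) auto
    also have "\<dots> \<longleftrightarrow> (AE \<omega> in M'. X' \<omega> \<in> C)"
      unfolding eq by (subst AE_distr_iff) auto
    finally show ?thesis .
  qed
  have 1: "measure M {\<omega> \<in> space M. X \<omega> = x} = measure M' {\<omega> \<in> space M'. X' \<omega> = x}" for x
    using m[of "{x}"] by simp
  have "(\<exists>C. countable C \<and> (AE \<omega> in M. X \<omega> \<in> C)) \<longleftrightarrow> (\<exists>C. countable C \<and> (AE \<omega> in M'. X' \<omega> \<in> C))"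
    using ae by blast
  then show ?thesis
    unfolding rv_support_def 1 using m by auto
qed

section \<open>Treatment paths and the first switching date\<close>

text \<open>Replaces the minimum by finitely many conditions on coordinates, from which
  measurability can be read off. The value \<open>T + 1\<close> codes a path without a switch, for
  which no deviation at \<open>f\<close> is required.\<close>

lemma first_switch_eq_iff:
  assumes "1 \<le> T"
  shows "first_switch T d = f \<longleftrightarrow>
    f \<in> {2..T + 1} \<and> (f \<le> T \<longrightarrow> d f \<noteq> d 1) \<and> (\<forall>s\<in>{2..<f}. d s = d 1)"
proof (cases "\<exists>t\<in>{2..T}. d t \<noteq> d 1")
  case True
  let ?A = "{t\<in>{2..T}. d t \<noteq> d 1}"
  define m where "m = Min ?A"
  have F: "first_switch T d = m" using True by (simp add: first_switch_def m_def)
  have A: "finite ?A" "?A \<noteq> {}" using True by auto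
  have m: "2 \<le> m" "m \<le> T" "d m \<noteq> d 1"
    using Min_in[OF A] unfolding m_def by auto
  have le: "m \<le> t" if "t \<in> {2..T}" "d t \<noteq> d 1" for t
    unfolding m_def using A(1) that by (intro Min_le) auto
  show ?thesis
    unfolding F
  proof
    assume "m = f"
    moreover have "d s = d 1" if "s \<in> {2..<m}" for s
      using le[of s] that m(2) by force
    ultimately show "f \<in> {2..T + 1} \<and> (f \<le> T \<longrightarrow> d f \<noteq> d 1) \<and> (\<forall>s\<in>{2..<f}. d s = d 1)"
      using m by auto
  next
    assume f: "f \<in> {2..T + 1} \<and> (f \<le> T \<longrightarrow> d f \<noteq> d 1) \<and> (\<forall>s\<in>{2..<f}. d s = d 1)"
    then have "\<not> m < f" using m by auto
    then show "m = f" using le[of f] f m by auto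
  qed
next
  case False
  then have "first_switch T d = T + 1" by (simp add: first_switch_def)
  with False assms show ?thesis by (auto simp: not_le)
qed

lemma first_switch_bounds:
  assumes "1 \<le> T"
  shows "2 \<le> first_switch T d" "first_switch T d \<le> T + 1"
  using first_switch_eq_iff[OF assms, of d "first_switch T d"] by auto

lemma eq_baseline_before_first_switch:
  assumes "1 \<le> T" "1 \<le> s" "s < first_switch T d"
  shows "d s = d 1"
  using first_switch_eq_iff[OF assms(1), of d "first_switch T d"] assms(2,3)
  by (cases "s = 1") auto

text \<open>On the product space a coordinate outside \<open>{1..T}\<close> is the constant
  \<open>undefined\<close>. Dates such as \<open>f - 1 + l\<close> can therefore be handled without
  range conditions.\<close>

lemma seq_algebra_component: "(\<lambda>d. d t) \<in> borel_measurable (seq_algebra T)"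
proof (cases "t \<in> {1..T}")
  case True
  then show ?thesis by (rule measurable_component_singleton)
next
  case False
  have "(\<lambda>d. d t) \<in> borel_measurable (seq_algebra T) \<longleftrightarrow>
        (\<lambda>d. undefined :: real) \<in> borel_measurable (seq_algebra T)"
    by (rule measurable_cong) (use False in \<open>auto simp: space_PiM PiE_def extensional_def\<close>)
  then show ?thesis by simp
qed

text \<open>\<open>rv_support\<close> of a path refers to the topology of
  \<open>nat \<Rightarrow> real\<close>, whereas paths are measurable into the finite product; this
  map links the two.\<close>

lemma seq_algebra_to_borel:
  "(\<lambda>d. d) \<in> seq_algebra T \<rightarrow>\<^sub>M (borel :: (nat \<Rightarrow> real) measure)"
  by (rule measurable_coordinatewise_then_product) (rule seq_algebra_component)

lemma first_switch_measurable:
  assumes "1 \<le> T"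
  shows "first_switch T \<in> seq_algebra T \<rightarrow>\<^sub>M count_space UNIV"
proof (rule measurable_count_space_eq2_countable[THEN iffD2], safe)
  fix f
  have eq: "Measurable.pred (seq_algebra T) (\<lambda>d. d s = d 1)" for s
    unfolding pred_def by (intro borel_measurable_eq seq_algebra_component)
  have "Measurable.pred (seq_algebra T) (\<lambda>d. first_switch T d = f)"
    unfolding first_switch_eq_iff[OF assms]
    by (intro pred_intros_logic pred_intros_countable_bounded eq) simp_all
  then show "first_switch T -` {f} \<inter> space (seq_algebra T) \<in> sets (seq_algebra T)"
    by (simp add: pred_def vimage_def Int_def conj_commute)
qed simp_all

text \<open>Finite support turns the variance into a finite sum of nonnegative terms, zero only if
  every possible value equals the mean. Two distinct possible switching dates are the usable form of
  positive variance, both for measurability of the relevant baselines and for the contradiction when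
  \<open>l = 1\<close>.\<close>

lemma variance_pmf_pos_iff:
  fixes p :: "nat pmf"
  assumes "finite (set_pmf p)"
  shows "measure_pmf.variance p real > 0 \<longleftrightarrow> (\<exists>a\<in>set_pmf p. \<exists>b\<in>set_pmf p. a \<noteq> b)"
proof -
  let ?m = "measure_pmf.expectation p real"
  have var: "measure_pmf.variance p real = (\<Sum>a\<in>set_pmf p. (real a - ?m)\<^sup>2 * pmf p a)"
    using assms by (rule integral_measure_pmf_real) 
  have ge0: "0 \<le> (real a - ?m)\<^sup>2 * pmf p a" for a by simp
  have "measure_pmf.variance p real = 0 \<longleftrightarrow> (\<forall>a\<in>set_pmf p. real a = ?m)"
    unfolding var using assms by (subst sum_nonneg_eq_0_iff) (auto simp: set_pmf_iff)
  moreover have "measure_pmf.variance p real \<ge> 0"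
    unfolding var by (intro sum_nonneg ge0)
  moreover have "(\<forall>a\<in>set_pmf p. real a = ?m) \<longleftrightarrow> (\<forall>a\<in>set_pmf p. \<forall>b\<in>set_pmf p. a = b)"
  proof
    assume all_eq: "\<forall>a\<in>set_pmf p. \<forall>b\<in>set_pmf p. a = b"
    obtain a where a: "a \<in> set_pmf p" using set_pmf_not_empty[of p] by blast
    with all_eq have "set_pmf p = {a}" by blast
    then have "p = return_pmf a" by (simp add: set_pmf_subset_singleton[symmetric])
    then have "?m = real a" by simp
    with \<open>set_pmf p = {a}\<close> show "\<forall>a\<in>set_pmf p. real a = ?m" by simp
  qed (metis of_nat_eq_iff)
  ultimately show ?thesis by (auto simp: less_le)
qed

section \<open>The conditional law of the switching date given the period-one treatment\<close>

locale treatment_design = prob_space M for M :: "'w measure" +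
  fixes T :: nat and D :: "nat \<Rightarrow> 'w \<Rightarrow> real" and \<kappa> :: "real \<Rightarrow> nat pmf"
  assumes T_pos: "1 \<le> T"
    and path_measurable [measurable]: "treatment_path T D \<in> M \<rightarrow>\<^sub>M seq_algebra T"
    and switch_kernel: "cond_dist_switch M T D \<kappa>"
begin

abbreviation F :: "'w \<Rightarrow> nat" where "F \<equiv> switch_date T D"
abbreviation \<B> :: "real set" where "\<B> \<equiv> relevant_baseline M D \<kappa>"
abbreviation baseline_algebra :: "'w measure" where
  "baseline_algebra \<equiv> vimage_algebra (space M) (D 1) borel"
abbreviation path_algebra :: "'w measure" where
  "path_algebra \<equiv> vimage_algebra (space M) (treatment_path T D) (seq_algebra T)"

lemma treatment_path_apply: "t \<in> {1..T} \<Longrightarrow> treatment_path T D \<omega> t = D t \<omega>"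
  by (simp add: treatment_path_def)

lemma path_1 [simp]: "treatment_path T D \<omega> (Suc 0) = D (Suc 0) \<omega>"
  using T_pos by (simp add: treatment_path_def)

lemma D_measurable [measurable]: "t \<in> {1..T} \<Longrightarrow> D t \<in> borel_measurable M"
  using measurable_compose[OF path_measurable seq_algebra_component[of t]]
  by (simp add: treatment_path_apply)

lemma D1_measurable [measurable]: "D 1 \<in> borel_measurable M" "D (Suc 0) \<in> borel_measurable M"
  using D_measurable[of 1] T_pos by simp_all

lemma F_measurable [measurable]: "F \<in> M \<rightarrow>\<^sub>M count_space UNIV"
  using measurable_compose[OF path_measurable first_switch_measurable[OF T_pos]]
  by (simp add: switch_date_def[abs_def])

lemma path_borel_measurable [measurable]: "treatment_path T D \<in> borel_measurable M"
  by (rule measurable_compose[OF path_measurable seq_algebra_to_borel])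

lemma F_bounds: "2 \<le> F \<omega>" "F \<omega> \<le> T + 1"
  using first_switch_bounds[OF T_pos] by (auto simp: switch_date_def)

lemma D_before_switch: "1 \<le> s \<Longrightarrow> s < F \<omega> \<Longrightarrow> D s \<omega> = D 1 \<omega>"
  using eq_baseline_before_first_switch[OF T_pos, of s "treatment_path T D \<omega>"] F_bounds(2)[of \<omega>] T_pos
  by (simp add: switch_date_def treatment_path_apply)

lemma subalgebra_baseline: "subalgebra M baseline_algebra"
  unfolding subalgebra_def by (auto simp: sets_vimage_algebra2)

lemma subalgebra_path: "subalgebra M path_algebra"
  unfolding subalgebra_def using measurable_space[OF path_measurable]
  by (auto simp: sets_vimage_algebra2 Pi_iff intro!: measurable_sets[OF path_measurable])

lemma D1_baseline_measurable [measurable]: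
  "D 1 \<in> borel_measurable (vimage_algebra (space M) (D 1) borel)"
  "D (Suc 0) \<in> borel_measurable (vimage_algebra (space M) (D (Suc 0)) borel)"
  by (auto intro: measurable_vimage_algebra1)

lemma path_path_measurable [measurable]: "treatment_path T D \<in> path_algebra \<rightarrow>\<^sub>M seq_algebra T"
  using measurable_space[OF path_measurable] by (intro measurable_vimage_algebra1) auto

lemma D1_path_measurable [measurable]: "D (Suc 0) \<in> borel_measurable path_algebra"
  using measurable_compose[OF path_path_measurable seq_algebra_component[of 1]] T_pos by simp

lemma sigma_finite_baseline: "sigma_finite_subalgebra M baseline_algebra"
  by (intro finite_measure_subalgebra_is_sigma_finite finite_measure_subalgebra.intro
      finite_measure_subalgebra_axioms.intro subalgebra_baseline finite_measure_axioms)

lemma sigma_finite_path: "sigma_finite_subalgebra M path_algebra"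
  by (intro finite_measure_subalgebra_is_sigma_finite finite_measure_subalgebra.intro
      finite_measure_subalgebra_axioms.intro subalgebra_path finite_measure_axioms)

lemma set_kernel: "d \<in> rv_support M (D 1) \<Longrightarrow> set_pmf (\<kappa> d) \<subseteq> {2..T + 1}"
  using switch_kernel by (auto simp: cond_dist_switch_def)

lemma kernel_measurable [measurable]: "(\<lambda>d. pmf (\<kappa> d) f) \<in> borel_measurable borel"
  using switch_kernel by (auto simp: cond_dist_switch_def cond_exp_version_def)

text \<open>Integrated form of the definition of \<open>\<kappa>\<close>. Both sides are integrals
  of functions of the path, so the identity can also be carried to another model.\<close>

lemma kernel_integral:
  assumes [measurable]: "B \<in> sets borel"
  shows "(LINT \<omega>|M. indicator B (D 1 \<omega>) * pmf (\<kappa> (D 1 \<omega>)) f) =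
         (LINT \<omega>|M. indicator B (D 1 \<omega>) * indicator {\<omega> \<in> space M. F \<omega> = f} \<omega>)"
proof -
  interpret S: sigma_finite_subalgebra M baseline_algebra by (rule sigma_finite_baseline)
  let ?I = "indicator {\<omega> \<in> space M. F \<omega> = f} :: 'w \<Rightarrow> real"
  have "AE \<omega> in M. real_cond_exp M baseline_algebra ?I \<omega> = pmf (\<kappa> (D 1 \<omega>)) f"
    using switch_kernel by (simp add: cond_dist_switch_def cond_exp_version_def)
  then have "AE \<omega> in M. indicator B (D 1 \<omega>) * pmf (\<kappa> (D 1 \<omega>)) f =
      indicator B (D 1 \<omega>) * real_cond_exp M baseline_algebra ?I \<omega>"
    by eventually_elim simp
  then have "(LINT \<omega>|M. indicator B (D 1 \<omega>) * pmf (\<kappa> (D 1 \<omega>)) f) =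
     (LINT \<omega>|M. indicator B (D 1 \<omega>) * real_cond_exp M baseline_algebra ?I \<omega>)"
    by (rule integral_cong_AE[rotated 2]) measurable
  also have "\<dots> = (LINT \<omega>|M. indicator B (D 1 \<omega>) * ?I \<omega>)"
  proof (rule S.real_cond_exp_intg(2))
    show "integrable M (\<lambda>\<omega>. indicator B (D 1 \<omega>) * ?I \<omega>)"
      by (rule integrable_const_bound[of _ 1]) (simp_all add: indicator_def)
    show "(\<lambda>\<omega>. indicator B (D 1 \<omega>)) \<in> borel_measurable baseline_algebra"
      by measurable
    show "?I \<in> borel_measurable M"
      by measurable
  qed
  finally show ?thesis .
qed

text \<open>The kernel mass is nonnegative and by \<open>kernel_integral\<close> has integral zero
  over \<open>B\<close>. This turns the almost sure absence of a switching date into a statement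
  about the kernel, and thereby about \<open>T_bar\<close> and the variance.\<close>

lemma AE_kernel_eq_0:
  assumes [measurable]: "B \<in> sets borel" and "AE \<omega> in M. D 1 \<omega> \<in> B \<longrightarrow> F \<omega> \<noteq> f"
  shows "AE \<omega> in M. D 1 \<omega> \<in> B \<longrightarrow> pmf (\<kappa> (D 1 \<omega>)) f = 0"
proof -
  have "(LINT \<omega>|M. indicator B (D 1 \<omega>) * pmf (\<kappa> (D 1 \<omega>)) f) = 0"
    unfolding kernel_integral[OF assms(1)]
  proof (rule integral_eq_zero_AE)
    show "AE \<omega> in M. indicator B (D 1 \<omega>) * indicator {\<omega> \<in> space M. F \<omega> = f} \<omega> = (0::real)"
      using assms(2) by eventually_elim (auto split: split_indicator)
  qed
  moreover have "integrable M (\<lambda>\<omega>. indicator B (D 1 \<omega>) * pmf (\<kappa> (D 1 \<omega>)) f)"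
    by (rule integrable_const_bound[of _ 1]) (simp_all add: indicator_def pmf_le_1)
  ultimately have "AE \<omega> in M. indicator B (D 1 \<omega>) * pmf (\<kappa> (D 1 \<omega>)) f = 0"
    by (simp add: integral_nonneg_eq_0_iff_AE)
  then show ?thesis
    by eventually_elim (auto split: split_indicator_asm)
qed

lemma baseline_support_measurable [measurable]: "rv_support M (D (Suc 0)) \<in> sets borel"
  by (rule rv_support_borel)

lemma AE_baseline_support: "AE \<omega> in M. D 1 \<omega> \<in> rv_support M (D 1)"
  by (rule AE_in_rv_support) simp

lemma relevant_iff:
  "d \<in> \<B> \<longleftrightarrow> d \<in> rv_support M (D 1) \<and>
     (\<exists>a\<in>{2..T+1}. \<exists>b\<in>{2..T+1}. a \<noteq> b \<and> pmf (\<kappa> d) a > 0 \<and> pmf (\<kappa> d) b > 0)"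
proof -
  have "cond_var_switch \<kappa> d > 0 \<longleftrightarrow>
      (\<exists>a\<in>{2..T+1}. \<exists>b\<in>{2..T+1}. a \<noteq> b \<and> pmf (\<kappa> d) a > 0 \<and> pmf (\<kappa> d) b > 0)"
    if d: "d \<in> rv_support M (D 1)"
  proof -
    have "finite (set_pmf (\<kappa> d))" using finite_subset[OF set_kernel[OF d]] by simp
    then have "cond_var_switch \<kappa> d > 0 \<longleftrightarrow> (\<exists>a\<in>set_pmf (\<kappa> d). \<exists>b\<in>set_pmf (\<kappa> d). a \<noteq> b)"
      unfolding cond_var_switch_def by (rule variance_pmf_pos_iff)
    also have "\<dots> \<longleftrightarrow> (\<exists>a\<in>{2..T+1}. \<exists>b\<in>{2..T+1}. a \<noteq> b \<and> a \<in> set_pmf (\<kappa> d) \<and> b \<in> set_pmf (\<kappa> d))"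
      using set_kernel[OF d] by blast
    finally show ?thesis by (simp add: pmf_positive_iff)
  qed
  then show ?thesis unfolding relevant_baseline_def by blast
qed

lemma relevant_measurable [measurable]: "\<B> \<in> sets borel"
proof -
  have "Measurable.pred borel
     (\<lambda>d. \<exists>a\<in>{2..T+1}. \<exists>b\<in>{2..T+1}. a \<noteq> b \<and> pmf (\<kappa> d) a > 0 \<and> pmf (\<kappa> d) b > 0)"
    by measurable
  then have "rv_support M (D 1) \<inter>
     {d. \<exists>a\<in>{2..T+1}. \<exists>b\<in>{2..T+1}. a \<noteq> b \<and> pmf (\<kappa> d) a > 0 \<and> pmf (\<kappa> d) b > 0} \<in> sets borel"
    by (simp add: pred_def)
  also have "rv_support M (D 1) \<inter>
     {d. \<exists>a\<in>{2..T+1}. \<exists>b\<in>{2..T+1}. a \<noteq> b \<and> pmf (\<kappa> d) a > 0 \<and> pmf (\<kappa> d) b > 0} = \<B>"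
    unfolding set_eq_iff relevant_iff by blast
  finally show ?thesis .
qed

section \<open>Measurability of the effect paths and of the effect event\<close>

lemma le_T_bar_iff:
  assumes d: "d \<in> rv_support M (D 1)"
  shows "m \<le> T_bar \<kappa> d \<longleftrightarrow> (\<exists>f\<in>{2..T + 1}. m \<le> f - 1 \<and> pmf (\<kappa> d) f > 0)"
proof -
  have "finite (set_pmf (\<kappa> d))" using finite_subset[OF set_kernel[OF d]] by simp
  then have "m \<le> T_bar \<kappa> d \<longleftrightarrow> (\<exists>f\<in>set_pmf (\<kappa> d). m \<le> f - 1)"
    unfolding T_bar_def using set_pmf_not_empty[of "\<kappa> d"] by (subst Max_ge_iff) auto
  also have "\<dots> \<longleftrightarrow> (\<exists>f\<in>{2..T + 1}. m \<le> f - 1 \<and> f \<in> set_pmf (\<kappa> d))"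
    using set_kernel[OF d] by blast
  finally show ?thesis by (simp add: pmf_positive_iff)
qed

lemma T_bar_le: "d \<in> rv_support M (D 1) \<Longrightarrow> T_bar \<kappa> d \<le> T"
  using le_T_bar_iff[of d "T_bar \<kappa> d"] by auto

text \<open>Once the switching date \<open>f\<close> is fixed, the minimum, the maximum and
  \<open>T_bar\<close> become finite quantifiers over coordinates and kernel masses, so
  measurability can be proved clause by clause. The range of \<open>f\<close> comes from
  \<open>T_bar \<le> T\<close> and excludes paths without a switch.\<close>

lemma effect_paths_iff:
  assumes l: "1 \<le> l"
  shows "d \<in> effect_paths M T D \<kappa> l \<longleftrightarrow>
    d \<in> rv_support M (treatment_path T D) \<and> d 1 \<in> \<B> \<and>
    (\<exists>f\<in>{2..T + 1 - l}. first_switch T d = f \<and>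
       (\<exists>b\<in>{2..T + 1}. f - 1 + l \<le> b - 1 \<and> pmf (\<kappa> (d 1)) b > 0) \<and>
       ((\<forall>s\<in>{1<..f - 1 + l}. d 1 \<le> d s) \<or> (\<forall>s\<in>{1<..f - 1 + l}. d s \<le> d 1)))"
proof (cases "d \<in> rv_support M (treatment_path T D) \<and> d 1 \<in> \<B>")
  case True
  then have d1: "d 1 \<in> rv_support M (D 1)" by (simp add: relevant_baseline_def)
  define f where "f = first_switch T d"
  have f2: "2 \<le> f" unfolding f_def by (rule first_switch_bounds[OF T_pos])
  \<comment> \<open>\<open>f \<ge> 2\<close> and \<open>l \<ge> 1\<close> make this set nonempty, as
    \<open>Min\<close> and \<open>Max\<close> require.\<close>
  have ne: "finite {1<..f - 1 + l}" "{1<..f - 1 + l} \<noteq> {}" using f2 l by auto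
  let ?nc = "\<lambda>f. (\<forall>s\<in>{1<..f - 1 + l}. d 1 \<le> d s) \<or> (\<forall>s\<in>{1<..f - 1 + l}. d s \<le> d 1)"
  let ?bar = "\<lambda>f. \<exists>b\<in>{2..T + 1}. f - 1 + l \<le> b - 1 \<and> pmf (\<kappa> (d 1)) b > 0"
  have minmax: "(Min (d ` {1<..f - 1 + l}) \<ge> d 1 \<or> Max (d ` {1<..f - 1 + l}) \<le> d 1) \<longleftrightarrow> ?nc f"
    using ne by (simp only: Min_ge_iff Max_le_iff finite_imageI image_is_empty simp_thms) blast
  have bar: "f - 1 + l \<le> T_bar \<kappa> (d 1) \<longleftrightarrow> f \<in> {2..T + 1 - l} \<and> ?bar f"
    using T_bar_le[OF d1] f2 le_T_bar_iff[OF d1, of "f - 1 + l"] by auto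
  have "d \<in> effect_paths M T D \<kappa> l \<longleftrightarrow> f \<in> {2..T + 1 - l} \<and> ?bar f \<and> ?nc f"
    using True
    by (simp only: effect_paths_def no_crossing_paths_def mem_Collect_eq f_def[symmetric] minmax bar
        simp_thms conj_assoc)
  also have "\<dots> \<longleftrightarrow> (\<exists>f'\<in>{2..T + 1 - l}. first_switch T d = f' \<and> ?bar f' \<and> ?nc f')"
    unfolding f_def by blast
  finally show ?thesis
    using True by blast
qed (auto simp: effect_paths_def)

lemma effect_paths_measurable:
  assumes l: "1 \<le> l"
  shows "Measurable.pred (seq_algebra T) (\<lambda>d. d \<in> effect_paths M T D \<kappa> l)"
proof -
  let ?P = "Measurable.pred (seq_algebra T)"
  have supp: "?P (\<lambda>d. d \<in> rv_support M (treatment_path T D))"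
    by (rule measurable_compose[OF seq_algebra_to_borel]) (simp add: pred_def rv_support_borel)
  have base: "?P (\<lambda>d. d 1 \<in> \<B>)"
    by (rule measurable_compose[OF seq_algebra_component]) (simp add: pred_def)
  have switch: "?P (\<lambda>d. first_switch T d = f)" for f
    by (rule measurable_compose[OF first_switch_measurable[OF T_pos]]) simp
  have kernel: "?P (\<lambda>d. pmf (\<kappa> (d 1)) b > 0)" for b
    by (rule measurable_compose[OF seq_algebra_component]) measurable
  have le: "?P (\<lambda>d. d s \<le> d t)" for s t
    unfolding pred_def by (intro borel_measurable_le seq_algebra_component)
  show ?thesis
    unfolding effect_paths_iff[OF l]
    by (intro pred_intros_logic pred_intros_countable_bounded supp base switch kernel le) simp_all
qed

lemma effect_event_measurable:
  assumes "1 \<le> l"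
  shows "effect_event M T D \<kappa> l \<in> sets M"
  using measurable_compose[OF path_measurable effect_paths_measurable[OF assms]]
  by (simp add: effect_event_def pred_def)

section \<open>Positive probability of the effect event at horizon one\<close>

lemma not_AE_irrelevant:
  assumes cont: "cond_var_continuous M D \<kappa>" and ne: "\<B> \<noteq> {}"
  shows "\<not> (AE \<omega> in M. D 1 \<omega> \<notin> \<B>)"
proof
  assume irrelevant: "AE \<omega> in M. D 1 \<omega> \<notin> \<B>"
  obtain d where d: "d \<in> \<B>" using ne by blast
  then have d_supp: "d \<in> rv_support M (D 1)" and var: "cond_var_switch \<kappa> d > 0"
    by (auto simp: relevant_baseline_def)
  have "AE \<omega> in M. D 1 \<omega> \<noteq> d"
    using irrelevant by eventually_elim (use d in auto)
  then have atom: "prob {\<omega> \<in> space M. D 1 \<omega> = d} = 0"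
    by (subst prob_eq_0) auto
  \<comment> \<open>A point of the support without mass can only come from the topological branch of
    \<open>rv_support\<close>, so its neighbourhoods have positive probability.\<close>
  with d_supp have open_pos: "prob {\<omega> \<in> space M. D 1 \<omega> \<in> U} > 0" if "open U" "d \<in> U" for U
    using that by (auto simp: rv_support_def split: if_splits)
  have "continuous (at d within rv_support M (D 1)) (cond_var_switch \<kappa>)"
    using cont d_supp atom unfolding cond_var_continuous_def by blast
  then have "eventually (\<lambda>x. cond_var_switch \<kappa> x > 0) (at d within rv_support M (D 1))"
    using var unfolding continuous_within by (rule order_tendstoD)
  then obtain U where U: "open U" "d \<in> U"
      "\<And>x. x \<in> U \<Longrightarrow> x \<noteq> d \<Longrightarrow> x \<in> rv_support M (D 1) \<Longrightarrow> cond_var_switch \<kappa> x > 0"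
    unfolding eventually_at_topological by blast
  have [measurable]: "U \<in> sets borel" using U(1) by simp
  have "AE \<omega> in M. D 1 \<omega> \<notin> U"
    using irrelevant AE_baseline_support
  proof eventually_elim
    case (elim \<omega>)
    then show ?case
      using U(3)[of "D 1 \<omega>"] var by (auto simp: relevant_baseline_def)
  qed
  then have "prob {\<omega> \<in> space M. D 1 \<omega> \<in> U} = 0"
    by (subst prob_eq_0) auto
  with open_pos[OF U(1,2)] show False by simp
qed

lemma AE_path_support: "AE \<omega> in M. treatment_path T D \<omega> \<in> rv_support M (treatment_path T D)"
  by (rule AE_in_rv_support) simp

lemma effect_event_iff:
  assumes "1 \<le> l"
  shows "\<omega> \<in> effect_event M T D \<kappa> l \<longleftrightarrow> \<omega> \<in> space M \<and>
    treatment_path T D \<omega> \<in> rv_support M (treatment_path T D) \<and> D 1 \<omega> \<in> \<B> \<and>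
    F \<omega> \<in> {2..T + 1 - l} \<and>
    (\<exists>b\<in>{2..T + 1}. F \<omega> - 1 + l \<le> b - 1 \<and> pmf (\<kappa> (D 1 \<omega>)) b > 0) \<and>
    ((\<forall>s\<in>{1<..F \<omega> - 1 + l}. D 1 \<omega> \<le> treatment_path T D \<omega> s) \<or>
     (\<forall>s\<in>{1<..F \<omega> - 1 + l}. treatment_path T D \<omega> s \<le> D 1 \<omega>))"
  unfolding effect_event_def mem_Collect_eq effect_paths_iff[OF assms]
  by (auto simp: switch_date_def)

lemma prob_effect_event_1_pos:
  assumes "cond_var_continuous M D \<kappa>" "\<B> \<noteq> {}"
  shows "prob (effect_event M T D \<kappa> 1) > 0"
proof (rule ccontr)
  assume "\<not> ?thesis"
  then have "prob (effect_event M T D \<kappa> 1) = 0"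
    using measure_nonneg[of M] by (simp add: less_le)
  then have "AE \<omega> in M. \<omega> \<notin> effect_event M T D \<kappa> 1"
    using effect_event_measurable[of 1] by (simp add: prob_eq_0)
  then have no_effect: "AE \<omega> in M. \<forall>b\<in>{2..T + 1}. D 1 \<omega> \<in> \<B> \<and> pmf (\<kappa> (D 1 \<omega>)) b > 0 \<longrightarrow> \<not> F \<omega> < b"
    using AE_path_support AE_space
  proof eventually_elim
    case (elim \<omega>)
    show ?case
    proof (safe, goal_cases)
      case (1 b)
      \<comment> \<open>For \<open>l = 1\<close> the no-crossing condition is automatic: before
        \<open>F\<close> the path stays at \<open>D 1\<close>, and the single deviation at
        \<open>F\<close> lies on one side of it.\<close>
      have "D 1 \<omega> \<le> treatment_path T D \<omega> s" if "D 1 \<omega> \<le> D (F \<omega>) \<omega>" "1 < s" "s \<le> F \<omega>" for s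
        using that D_before_switch[of s \<omega>] F_bounds[of \<omega>] 1
        by (cases "s = F \<omega>") (auto simp: treatment_path_apply)
      moreover have "treatment_path T D \<omega> s \<le> D 1 \<omega>" if "D (F \<omega>) \<omega> \<le> D 1 \<omega>" "1 < s" "s \<le> F \<omega>" for s
        using that D_before_switch[of s \<omega>] F_bounds[of \<omega>] 1
        by (cases "s = F \<omega>") (auto simp: treatment_path_apply)
      ultimately have "(\<forall>s\<in>{1<..F \<omega> - 1 + 1}. D 1 \<omega> \<le> treatment_path T D \<omega> s) \<or>
          (\<forall>s\<in>{1<..F \<omega> - 1 + 1}. treatment_path T D \<omega> s \<le> D 1 \<omega>)"
        using F_bounds(1)[of \<omega>] by (cases "D 1 \<omega> \<le> D (F \<omega>) \<omega>") auto
      moreover have "F \<omega> \<in> {2..T + 1 - 1}" "F \<omega> - 1 + 1 \<le> b - 1"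
        using 1 F_bounds[of \<omega>] by auto
      ultimately show False
        using elim 1 effect_event_iff[of 1 \<omega>] by blast
    qed
  qed
  have "AE \<omega> in M. \<forall>b\<in>{2..T + 1}. \<forall>f\<in>{2..T + 1}.
      f < b \<and> D 1 \<omega> \<in> \<B> \<and> pmf (\<kappa> (D 1 \<omega>)) b > 0 \<longrightarrow> pmf (\<kappa> (D 1 \<omega>)) f = 0"
  proof (intro AE_finite_allI)
    fix b f assume b: "b \<in> {2..T + 1}"
    \<comment> \<open>Relevant baselines at which the later date \<open>b\<close> is possible: there
      \<open>F\<close> almost surely avoids \<open>f\<close>, so the kernel cannot charge
      \<open>f\<close> either.\<close>
    let ?B = "\<B> \<inter> {d \<in> space borel. pmf (\<kappa> d) b > 0}"
    show "AE \<omega> in M. f < b \<and> D 1 \<omega> \<in> \<B> \<and> pmf (\<kappa> (D 1 \<omega>)) b > 0 \<longrightarrow> pmf (\<kappa> (D 1 \<omega>)) f = 0"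
    proof (cases "f < b")
      case True
      have "AE \<omega> in M. D 1 \<omega> \<in> ?B \<longrightarrow> F \<omega> \<noteq> f"
        using no_effect by eventually_elim (use b True in auto)
      then have "AE \<omega> in M. D 1 \<omega> \<in> ?B \<longrightarrow> pmf (\<kappa> (D 1 \<omega>)) f = 0"
        by (rule AE_kernel_eq_0[rotated]) measurable
      then show ?thesis by eventually_elim simp
    qed simp
  qed simp_all
  then have "AE \<omega> in M. D 1 \<omega> \<notin> \<B>"
  proof eventually_elim
    case (elim \<omega>)
    show ?case
    proof
      assume rel: "D 1 \<omega> \<in> \<B>"
      then obtain a b where "a \<in> {2..T + 1}" "b \<in> {2..T + 1}" "a \<noteq> b"
          "pmf (\<kappa> (D 1 \<omega>)) a > 0" "pmf (\<kappa> (D 1 \<omega>)) b > 0"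
        unfolding relevant_iff by blast
      with elim rel show False
        by (metis less_irrefl linorder_neqE_nat)
    qed
  qed
  with not_AE_irrelevant[OF assms] show False by contradiction
qed

text \<open>
  On the effect event \<open>F - 1 + l \<le> T_bar\<close>, so given \<open>D\<^sub>1\<close> there is positive probability of a
  group that has not switched by \<open>F - 1 + l\<close>.  Hence agreement on such groups suffices.
\<close>
lemma AE_effect_event_eq:
  fixes u v :: "real \<Rightarrow> real"
  assumes l: "1 \<le> l" and [measurable]: "u \<in> borel_measurable borel" "v \<in> borel_measurable borel"
    and eq: "AE \<omega> in M. D 1 \<omega> \<in> \<B> \<and> F \<omega> > f - 1 + l \<longrightarrow> u (D 1 \<omega>) = v (D 1 \<omega>)"
  shows "AE \<omega> in M. \<omega> \<in> effect_event M T D \<kappa> l \<and> F \<omega> = f \<longrightarrow> u (D 1 \<omega>) = v (D 1 \<omega>)"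
proof -
  \<comment> \<open>Relevant baselines at which \<open>u\<close> and \<open>v\<close> disagree. By
    \<open>eq\<close> no switching date beyond \<open>f - 1 + l\<close> occurs there, so the kernel
    gives these dates mass zero; on the effect event with \<open>F = f\<close> one of them has
    positive mass.\<close>
  let ?N = "\<B> \<inter> {d \<in> space borel. u d \<noteq> v d}"
  have N [measurable]: "?N \<in> sets borel" by measurable
  have "AE \<omega> in M. \<forall>b\<in>{f - 1 + l + 1..T + 1}. D 1 \<omega> \<in> ?N \<longrightarrow> pmf (\<kappa> (D 1 \<omega>)) b = 0"
  proof (rule AE_finite_allI)
    fix b assume b: "b \<in> {f - 1 + l + 1..T + 1}"
    have "AE \<omega> in M. D 1 \<omega> \<in> ?N \<longrightarrow> F \<omega> \<noteq> b"
      using eq by eventually_elim (use b l in auto)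
    then show "AE \<omega> in M. D 1 \<omega> \<in> ?N \<longrightarrow> pmf (\<kappa> (D 1 \<omega>)) b = 0"
      by (rule AE_kernel_eq_0[OF N])
  qed simp
  then show ?thesis
  proof eventually_elim
    case (elim \<omega>)
    show ?case
    proof
      assume \<omega>: "\<omega> \<in> effect_event M T D \<kappa> l \<and> F \<omega> = f"
      then obtain b where b: "b \<in> {2..T + 1}" "f - 1 + l \<le> b - 1" "pmf (\<kappa> (D 1 \<omega>)) b > 0"
          and rel: "D 1 \<omega> \<in> \<B>"
        unfolding effect_event_iff[OF l] by blast
      have "b \<in> {f - 1 + l + 1..T + 1}"
        using b F_bounds[of \<omega>] \<omega> by auto
      with elim b(3) have "D 1 \<omega> \<notin> ?N" by fastforce
      with rel show "u (D 1 \<omega>) = v (D 1 \<omega>)" by simp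
    qed
  qed
qed

end


section \<open>Status-quo trends and the effect of switching\<close>

definition path_sign :: "nat \<Rightarrow> treatment_seq \<Rightarrow> real" where
  "path_sign T d = (if first_switch T d \<le> T then sgn (d (first_switch T d) - d 1) else 0)"

lemma path_sign_measurable:
  assumes "1 \<le> T"
  shows "path_sign T \<in> borel_measurable (seq_algebra T)"
proof -
  have "(\<lambda>d. if f \<le> T then sgn (d f - d 1) else 0) \<in> borel_measurable (seq_algebra T)" for f
  proof -
    note [measurable] = seq_algebra_component[of f] seq_algebra_component[of 1]
    show ?thesis
      unfolding sgn_real_def by measurable
  qed
  then show ?thesis
    unfolding path_sign_def[abs_def]
    by (rule measurable_compose_countable[OF _ first_switch_measurable[OF assms]])
qed

lemma abs_path_sign_le_1: "\<bar>path_sign T d\<bar> \<le> 1"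
  by (simp add: path_sign_def sgn_real_def)

text \<open>The integrand of the claimed formula as a function on the space of observables, cut to a
  set \<open>A\<close> of paths. Two models with the same law of the observables integrate the same
  function as soon as their effect paths agree.\<close>

definition effect_contrast ::
  "nat \<Rightarrow> nat \<Rightarrow> treatment_seq set \<Rightarrow> (real \<Rightarrow> nat \<Rightarrow> real) \<Rightarrow> (nat \<Rightarrow> real) \<times> treatment_seq \<Rightarrow> real"
  where "effect_contrast T l A \<Delta> = (\<lambda>(y, d). indicator A d * (path_sign T d *
    (y (first_switch T d - 1 + l) - y (first_switch T d - 1) - \<Delta> (d 1) (first_switch T d))))"

locale parallel_trends_design = treatment_design M T D \<kappa>
  for M :: "'w measure" and T D \<kappa> +
  fixes Y :: "nat \<Rightarrow> treatment_seq \<Rightarrow> 'w \<Rightarrow> real"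
  assumes outcomes: "outcomes_measurable M T Y D"
    and trends: "parallel_trends M T Y D \<kappa>"
begin

abbreviation Yo :: "nat \<Rightarrow> 'w \<Rightarrow> real" where "Yo \<equiv> observed Y D"
abbreviation Y0 :: "nat \<Rightarrow> 'w \<Rightarrow> real" where "Y0 \<equiv> status_quo Y D"
abbreviation Obs :: "((nat \<Rightarrow> real) \<times> (nat \<Rightarrow> real)) measure" where
  "Obs \<equiv> seq_algebra T \<Otimes>\<^sub>M seq_algebra T"

lemma outcome_measurable:
  assumes "t \<in> {1..T}"
  shows "Yo t \<in> borel_measurable M" "Y0 t \<in> borel_measurable M"
  using outcomes assms by (auto simp: outcomes_measurable_def)

lemma observed_eq_status_quo: "t < F \<omega> \<Longrightarrow> Yo t \<omega> = Y0 t \<omega>"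
  unfolding observed_def status_quo_def
  by (rule arg_cong[of _ _ "\<lambda>d. Y t d \<omega>"], rule restrict_ext) (rule D_before_switch, auto)

lemma switch_sign_path: "switch_sign T D \<omega> = path_sign T (treatment_path T D \<omega>)"
  using F_bounds[of \<omega>]
  by (auto simp: switch_sign_def path_sign_def switch_date_def treatment_path_apply)

lemma observables_measurable: "observables T Y D \<in> M \<rightarrow>\<^sub>M Obs"
  unfolding observables_def[abs_def]
  by (intro measurable_Pair measurable_restrict path_measurable outcome_measurable)

lemma effect_contrast_measurable:
  assumes l: "1 \<le> l" and \<Delta>: "\<And>f. f \<in> {2..T + 1 - l} \<Longrightarrow> (\<lambda>d. \<Delta> d f) \<in> borel_measurable borel"
  shows "effect_contrast T l (effect_paths M T D \<kappa> l) \<Delta> \<in> borel_measurable Obs"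
proof -
  let ?A = "effect_paths M T D \<kappa> l"
  \<comment> \<open>\<open>\<Delta>\<close> is known to be measurable only at dates with
    \<open>f - 1 + l \<le> T\<close>; elsewhere it is replaced by 0, which the indicator of the
    effect paths hides.\<close>
  define \<Delta>' where "\<Delta>' f d = (if f \<in> {2..T + 1 - l} then \<Delta> d f else 0)" for f d
  have [measurable]: "\<Delta>' f \<in> borel_measurable borel" for f
    using \<Delta>[of f] by (cases "f \<in> {2..T + 1 - l}") (simp_all only: \<Delta>'_def[abs_def] if_True if_False borel_measurable_const)
  have [measurable]: "(\<lambda>x. snd x s) \<in> borel_measurable Obs" "(\<lambda>x. fst x s) \<in> borel_measurable Obs" for s
    by (auto intro: measurable_compose[OF _ seq_algebra_component])
  have [measurable]: "(\<lambda>x. path_sign T (snd x)) \<in> borel_measurable Obs"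
    by (rule measurable_compose[OF measurable_snd path_sign_measurable[OF T_pos]])
  have [measurable]: "Measurable.pred Obs (\<lambda>x. snd x \<in> ?A)"
    by (rule measurable_compose[OF measurable_snd effect_paths_measurable[OF l]])
  have "(\<lambda>x. (\<lambda>f x. indicator ?A (snd x) * (path_sign T (snd x) *
      (fst x (f - 1 + l) - fst x (f - 1) - \<Delta>' f (snd x 1)))) (first_switch T (snd x)) x)
      \<in> borel_measurable Obs"
    by (rule measurable_compose_countable[OF _
          measurable_compose[OF measurable_snd first_switch_measurable[OF T_pos]]]) measurable
  also have "(\<lambda>x. (\<lambda>f x. indicator ?A (snd x) * (path_sign T (snd x) *
      (fst x (f - 1 + l) - fst x (f - 1) - \<Delta>' f (snd x 1)))) (first_switch T (snd x)) x) =
      effect_contrast T l ?A \<Delta>"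
    using effect_paths_iff[OF l]
    by (auto simp: effect_contrast_def fun_eq_iff \<Delta>'_def split: split_indicator)
  finally show ?thesis .
qed

lemma contrast_at_observables:
  assumes l: "1 \<le> l" and \<omega>: "\<omega> \<in> space M"
  shows "effect_contrast T l (effect_paths M T D \<kappa> l) \<Delta> (observables T Y D \<omega>) =
    indicator (effect_event M T D \<kappa> l) \<omega> * (switch_sign T D \<omega> *
       (Yo (F \<omega> - 1 + l) \<omega> - Yo (F \<omega> - 1) \<omega> - \<Delta> (D 1 \<omega>) (F \<omega>)))"
proof (cases "\<omega> \<in> effect_event M T D \<kappa> l")
  case True
  then have path: "treatment_path T D \<omega> \<in> effect_paths M T D \<kappa> l"
    by (simp add: effect_event_def)
  have "F \<omega> \<in> {2..T + 1 - l}"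
    using True effect_event_iff[OF l] by blast
  \<comment> \<open>Observables are restricted to \<open>{1..T}\<close>, so they return the outcomes
    at these two dates only because both lie in that range.\<close>
  then have "F \<omega> - 1 + l \<in> {1..T}" "F \<omega> - 1 \<in> {1..T}"
    by auto
  then have "fst (observables T Y D \<omega>) (F \<omega> - 1 + l) = Yo (F \<omega> - 1 + l) \<omega>"
      "fst (observables T Y D \<omega>) (F \<omega> - 1) = Yo (F \<omega> - 1) \<omega>"
    by (simp_all only: observables_def fst_conv restrict_apply' if_True)
  then show ?thesis
    using True path
    by (simp add: effect_contrast_def observables_def switch_sign_path switch_date_def)
next
  case False
  then have "treatment_path T D \<omega> \<notin> effect_paths M T D \<kappa> l"
    using \<omega> by (simp add: effect_event_def)
  with False show ?thesis
    by (simp add: effect_contrast_def observables_def)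
qed

lemma event_exp_contrast:
  assumes l: "1 \<le> l"
  shows "event_exp M (\<lambda>\<omega>. switch_sign T D \<omega> *
       (Yo (F \<omega> - 1 + l) \<omega> - Yo (F \<omega> - 1) \<omega> - \<Delta> (D 1 \<omega>) (F \<omega>))) (effect_event M T D \<kappa> l) =
    (LINT \<omega>|M. effect_contrast T l (effect_paths M T D \<kappa> l) \<Delta> (observables T Y D \<omega>)) /
    prob (effect_event M T D \<kappa> l)"
proof -
  have "(LINT \<omega>:effect_event M T D \<kappa> l|M. switch_sign T D \<omega> *
       (Yo (F \<omega> - 1 + l) \<omega> - Yo (F \<omega> - 1) \<omega> - \<Delta> (D 1 \<omega>) (F \<omega>))) =
      (LINT \<omega>|M. effect_contrast T l (effect_paths M T D \<kappa> l) \<Delta> (observables T Y D \<omega>))"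
    unfolding set_lebesgue_integral_def real_scaleR_def
    by (intro Bochner_Integration.integral_cong refl contrast_at_observables[symmetric] l)
  then show ?thesis by (simp only: event_exp_def)
qed

text \<open>Once \<open>\<Delta>\<close> is fixed, the model enters the right-hand side only through
  the law of the observables and the effect paths. This is the form in which two models are
  compared.\<close>

lemma event_exp_contrast_distr:
  assumes l: "1 \<le> l" and \<Delta>: "\<And>f. f \<in> {2..T + 1 - l} \<Longrightarrow> (\<lambda>d. \<Delta> d f) \<in> borel_measurable borel"
  shows "event_exp M (\<lambda>\<omega>. switch_sign T D \<omega> *
       (Yo (F \<omega> - 1 + l) \<omega> - Yo (F \<omega> - 1) \<omega> - \<Delta> (D 1 \<omega>) (F \<omega>))) (effect_event M T D \<kappa> l) =
    (LINT x|observables_dist M T Y D. effect_contrast T l (effect_paths M T D \<kappa> l) \<Delta> x) /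
    measure (observables_dist M T Y D) {x \<in> space Obs. snd x \<in> effect_paths M T D \<kappa> l}"
proof -
  have num: "(LINT x|observables_dist M T Y D. effect_contrast T l (effect_paths M T D \<kappa> l) \<Delta> x) =
      (LINT \<omega>|M. effect_contrast T l (effect_paths M T D \<kappa> l) \<Delta> (observables T Y D \<omega>))"
    unfolding observables_dist_def
    by (rule integral_distr[OF observables_measurable effect_contrast_measurable[OF l \<Delta>]])
  have "{x \<in> space Obs. snd x \<in> effect_paths M T D \<kappa> l} \<in> sets Obs"
    using measurable_compose[OF measurable_snd effect_paths_measurable[OF l]]
    by (simp add: pred_def)
  then have "measure (observables_dist M T Y D) {x \<in> space Obs. snd x \<in> effect_paths M T D \<kappa> l} =
      prob (observables T Y D -` {x \<in> space Obs. snd x \<in> effect_paths M T D \<kappa> l} \<inter> space M)"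
    unfolding observables_dist_def by (rule measure_distr[OF observables_measurable])
  also have "observables T Y D -` {x \<in> space Obs. snd x \<in> effect_paths M T D \<kappa> l} \<inter> space M =
      effect_event M T D \<kappa> l"
    using measurable_space[OF observables_measurable]
    by (auto simp: effect_event_def observables_def)
  finally show ?thesis
    unfolding event_exp_contrast[OF l] num by simp
qed

lemma avsq_integrand_measurable:
  assumes l: "1 \<le> l" and A: "A \<in> sets M" "\<And>\<omega>. \<omega> \<in> A \<Longrightarrow> F \<omega> \<in> {2..T + 1 - l}"
  shows "(\<lambda>\<omega>. indicator A \<omega> * avsq_integrand T Y D l \<omega>) \<in> borel_measurable M"
proof -
  \<comment> \<open>Outcomes are known to be measurable only at dates in \<open>{1..T}\<close>; the
    default 0 at the other \<open>f\<close> is never seen on \<open>A\<close>.\<close>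
  define V where "V f \<omega> = (if f \<in> {2..T + 1 - l} then Yo (f - 1 + l) \<omega> - Y0 (f - 1 + l) \<omega> else 0)" for f \<omega>
  have V: "V f \<in> borel_measurable M" for f
  proof (cases "f \<in> {2..T + 1 - l}")
    case True
    then have "f - 1 + l \<in> {1..T}" by auto
    then have "(\<lambda>\<omega>. Yo (f - 1 + l) \<omega> - Y0 (f - 1 + l) \<omega>) \<in> borel_measurable M"
      by (intro borel_measurable_diff outcome_measurable)
    with True show ?thesis by (simp only: V_def[abs_def] if_True)
  next
    case False
    then show ?thesis by (simp only: V_def[abs_def] if_False borel_measurable_const)
  qed
  have "switch_sign T D \<in> borel_measurable M"
    unfolding switch_sign_path[abs_def]
    by (rule measurable_compose[OF path_measurable path_sign_measurable[OF T_pos]])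
  then have "(\<lambda>\<omega>. indicator A \<omega> * (switch_sign T D \<omega> * V (F \<omega>) \<omega>)) \<in> borel_measurable M"
    using A(1) measurable_compose_countable[OF V F_measurable]
    by (intro borel_measurable_times borel_measurable_indicator)
  also have "(\<lambda>\<omega>. indicator A \<omega> * (switch_sign T D \<omega> * V (F \<omega>) \<omega>)) =
      (\<lambda>\<omega>. indicator A \<omega> * avsq_integrand T Y D l \<omega>)"
    using A(2) by (auto simp: fun_eq_iff V_def avsq_integrand_def split: split_indicator)
  finally show ?thesis .
qed

text \<open>
  As \<open>W\<close> may depend on the whole path, this says that \<open>h(D\<^sub>1)\<close> is a version of the conditional
  expectation of \<open>Y\<^sub>t(D\<^sub>1,\<dots>,D\<^sub>1) - Y\<^sub>s(D\<^sub>1,\<dots>,D\<^sub>1)\<close> given \<open>D\<close>, not only given \<open>D\<^sub>1\<close>.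
\<close>
definition is_trend :: "nat \<Rightarrow> nat \<Rightarrow> (real \<Rightarrow> real) \<Rightarrow> bool" where
  "is_trend s t h \<longleftrightarrow> h \<in> borel_measurable borel \<and> integrable M (\<lambda>\<omega>. h (D 1 \<omega>)) \<and>
     integrable M (\<lambda>\<omega>. indicator \<B> (D 1 \<omega>) * (Y0 t \<omega> - Y0 s \<omega>)) \<and>
     (\<forall>W\<in>borel_measurable path_algebra. (\<forall>\<omega>. \<bar>W \<omega>\<bar> \<le> 1) \<longrightarrow>
        (LINT \<omega>|M. W \<omega> * (indicator \<B> (D 1 \<omega>) * (Y0 t \<omega> - Y0 s \<omega>))) =
        (LINT \<omega>|M. W \<omega> * h (D 1 \<omega>)))"

section \<open>Existence of status-quo trends that depend on the baseline only\<close>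

lemma integrable_bounded_mult:
  fixes W X :: "'w \<Rightarrow> real"
  assumes "W \<in> borel_measurable M" "\<And>\<omega>. \<bar>W \<omega>\<bar> \<le> 1" "integrable M X"
  shows "integrable M (\<lambda>\<omega>. W \<omega> * X \<omega>)"
proof (rule Bochner_Integration.integrable_bound[OF assms(3)])
  show "(\<lambda>\<omega>. W \<omega> * X \<omega>) \<in> borel_measurable M"
    using assms(1,3) by measurable
  show "AE \<omega> in M. norm (W \<omega> * X \<omega>) \<le> norm (X \<omega>)"
    using mult_right_mono[OF assms(2) abs_ge_zero] by (simp add: abs_mult)
qed

text \<open>The cut set \<open>?R\<close> is determined by \<open>D 1\<close> and belongs to both
  algebras. Its indicator can thus be taken out of both conditional expectations, and parallel
  trends compares what remains on \<open>?R\<close>.\<close>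

lemma increment_cond_exp:
  assumes t: "t \<in> {2..T}"
  defines "X \<equiv> \<lambda>\<omega>. indicator \<B> (D 1 \<omega>) * (Y0 t \<omega> - Y0 (t - 1) \<omega>)"
  shows "integrable M X"
    and "AE \<omega> in M. real_cond_exp M path_algebra X \<omega> = real_cond_exp M baseline_algebra X \<omega>"
proof -
  let ?Z = "\<lambda>\<omega>. Y0 t \<omega> - Y0 (t - 1) \<omega>"
  let ?R = "{\<omega> \<in> space M. D 1 \<omega> \<in> \<B>}"
  have Z: "?Z \<in> borel_measurable M"
    using t by (intro borel_measurable_diff outcome_measurable) auto
  have X_eq: "X \<omega> = indicator ?R \<omega> * ?Z \<omega>" if "\<omega> \<in> space M" for \<omega>
    using that by (simp add: X_def indicator_def)
  have "set_integrable M ?R ?Z"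
    using trends t by (simp add: parallel_trends_def Let_def)
  then show int: "integrable M X"
    unfolding set_integrable_def
    by (rule Bochner_Integration.integrable_cong[THEN iffD1, rotated -1]) (simp_all add: X_eq)
  have X: "X \<in> borel_measurable M" and R: "?R \<in> sets M"
    using int by (auto intro: measurable_sets_borel)
  have R_sub: "?R \<in> sets path_algebra" "?R \<in> sets baseline_algebra"
    using measurable_sets[OF D1_path_measurable relevant_measurable]
      measurable_sets[OF D1_baseline_measurable(1) relevant_measurable]
    by (simp_all add: vimage_def Int_def conj_commute)
  have local: "AE \<omega> in M. real_cond_exp M \<A> X \<omega> = indicator ?R \<omega> * real_cond_exp M \<A> ?Z \<omega>"
    if "sigma_finite_subalgebra M \<A>" "?R \<in> sets \<A>" for \<A>
  proof -
    interpret sigma_finite_subalgebra M \<A> by fact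
    have "AE \<omega> in M. X \<omega> = indicator ?R \<omega> * ?Z \<omega>"
      using X_eq by simp
    then have "AE \<omega> in M. real_cond_exp M \<A> X \<omega> = real_cond_exp M \<A> (\<lambda>\<omega>. indicator ?R \<omega> * ?Z \<omega>) \<omega>"
      using X R Z by (intro real_cond_exp_cong) auto
    moreover have "AE \<omega> in M. real_cond_exp M \<A> (\<lambda>\<omega>. indicator ?R \<omega> * ?Z \<omega>) \<omega> =
        indicator ?R \<omega> * real_cond_exp M \<A> ?Z \<omega>"
      by (rule real_cond_exp_indicator_mult[OF that Z])
    ultimately show ?thesis by eventually_elim simp
  qed
  have "AE \<omega> in M. D 1 \<omega> \<in> \<B> \<longrightarrow>
      real_cond_exp M path_algebra ?Z \<omega> = real_cond_exp M baseline_algebra ?Z \<omega>"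
    using trends t by (simp add: parallel_trends_def Let_def)
  with local[OF sigma_finite_path R_sub(1)] local[OF sigma_finite_baseline R_sub(2)]
  show "AE \<omega> in M. real_cond_exp M path_algebra X \<omega> = real_cond_exp M baseline_algebra X \<omega>"
    by eventually_elim (auto simp: indicator_def)
qed

text \<open>A path-measurable weight may be tested against the conditional expectation given the
  path instead of the increment. Parallel trends replaces that expectation by the one given
  \<open>D 1\<close>, and Doob-Dynkin writes the latter as \<open>h (D 1 \<omega>)\<close>.\<close>

lemma is_trend_increment:
  assumes t: "t \<in> {2..T}"
  shows "\<exists>h. is_trend (t - 1) t h"
proof -
  let ?X = "\<lambda>\<omega>. indicator \<B> (D 1 \<omega>) * (Y0 t \<omega> - Y0 (t - 1) \<omega>)"
  interpret P: sigma_finite_subalgebra M path_algebra by (rule sigma_finite_path)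
  interpret B: sigma_finite_subalgebra M baseline_algebra by (rule sigma_finite_baseline)
  note X = increment_cond_exp[OF t]
  have "D 1 \<in> space M \<rightarrow> space borel" by simp
  then obtain h where h: "h \<in> borel_measurable borel"
      "\<And>\<omega>. \<omega> \<in> space M \<Longrightarrow> real_cond_exp M baseline_algebra ?X \<omega> = h (D 1 \<omega>)"
    using borel_measurable_vimage_algebra_factor[OF _ borel_measurable_cond_exp] by blast
  have "is_trend (t - 1) t h"
    unfolding is_trend_def
  proof (intro conjI ballI impI)
    show "integrable M (\<lambda>\<omega>. h (D 1 \<omega>))"
      using B.real_cond_exp_int(1)[OF X(1)] h(2)
      by (rule Bochner_Integration.integrable_cong[THEN iffD1, OF refl, rotated])
    fix W :: "'w \<Rightarrow> real"
    assume W: "W \<in> borel_measurable path_algebra" "\<forall>\<omega>. \<bar>W \<omega>\<bar> \<le> 1"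
    have W_M: "W \<in> borel_measurable M"
      by (rule measurable_from_subalg[OF subalgebra_path W(1)])
    have "integrable M (\<lambda>\<omega>. W \<omega> * ?X \<omega>)"
      by (rule integrable_bounded_mult[OF W_M _ X(1)]) (use W(2) in blast)
    then have "(LINT \<omega>|M. W \<omega> * ?X \<omega>) = (LINT \<omega>|M. W \<omega> * real_cond_exp M path_algebra ?X \<omega>)"
      by (rule P.real_cond_exp_intg(2)[OF _ W(1) borel_measurable_integrable[OF X(1)], symmetric])
    also have "\<dots> = (LINT \<omega>|M. W \<omega> * real_cond_exp M baseline_algebra ?X \<omega>)"
    proof (rule integral_cong_AE)
      show "AE \<omega> in M. W \<omega> * real_cond_exp M path_algebra ?X \<omega> =
          W \<omega> * real_cond_exp M baseline_algebra ?X \<omega>"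
        using X(2) by eventually_elim simp
    qed (use W_M in \<open>auto intro!: borel_measurable_times\<close>)
    also have "\<dots> = (LINT \<omega>|M. W \<omega> * h (D 1 \<omega>))"
      by (intro Bochner_Integration.integral_cong refl) (simp only: h(2))
    finally show "(LINT \<omega>|M. W \<omega> * ?X \<omega>) = (LINT \<omega>|M. W \<omega> * h (D 1 \<omega>))" .
  qed (use h X in auto)
  then show ?thesis by blast
qed

lemma is_trend_trans:
  assumes "is_trend s r h" "is_trend r t k"
  shows "is_trend s t (\<lambda>d. h d + k d)"
  unfolding is_trend_def
proof (intro conjI ballI impI)
  let ?X = "\<lambda>s t \<omega>. indicator \<B> (D 1 \<omega>) * (Y0 t \<omega> - Y0 s \<omega>)"
  note h = assms(1)[unfolded is_trend_def] and k = assms(2)[unfolded is_trend_def]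
  have X: "?X s t \<omega> = ?X s r \<omega> + ?X r t \<omega>" for \<omega>
    by (simp add: algebra_simps)
  show "(\<lambda>d. h d + k d) \<in> borel_measurable borel"
    using h k by (intro borel_measurable_add) auto
  show "integrable M (\<lambda>\<omega>. h (D 1 \<omega>) + k (D 1 \<omega>))"
    using h k by (intro Bochner_Integration.integrable_add) auto
  show "integrable M (?X s t)"
    unfolding X using h k by (intro Bochner_Integration.integrable_add) auto
  fix W :: "'w \<Rightarrow> real"
  assume W: "W \<in> borel_measurable path_algebra" "\<forall>\<omega>. \<bar>W \<omega>\<bar> \<le> 1"
  have int: "integrable M (\<lambda>\<omega>. W \<omega> * Z \<omega>)" if "integrable M Z" for Z
    using W that measurable_from_subalg[OF subalgebra_path W(1)] by (intro integrable_bounded_mult) auto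
  have "(LINT \<omega>|M. W \<omega> * ?X s t \<omega>) = (LINT \<omega>|M. W \<omega> * ?X s r \<omega>) + (LINT \<omega>|M. W \<omega> * ?X r t \<omega>)"
    unfolding X distrib_left using h k by (intro Bochner_Integration.integral_add int) auto
  also have "\<dots> = (LINT \<omega>|M. W \<omega> * h (D 1 \<omega>)) + (LINT \<omega>|M. W \<omega> * k (D 1 \<omega>))"
    using h k W by auto
  also have "\<dots> = (LINT \<omega>|M. W \<omega> * (h (D 1 \<omega>) + k (D 1 \<omega>)))"
    unfolding distrib_left using h k by (intro Bochner_Integration.integral_add[symmetric] int) auto
  finally show "(LINT \<omega>|M. W \<omega> * ?X s t \<omega>) = (LINT \<omega>|M. W \<omega> * (h (D 1 \<omega>) + k (D 1 \<omega>)))" .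
qed

text \<open>Parallel trends speaks of one-period increments; telescoping from \<open>s\<close> to
  \<open>t\<close> adds up their trend functions.\<close>

lemma trend_exists:
  assumes "1 \<le> s" "s \<le> t" "t \<le> T"
  shows "\<exists>h. is_trend s t h"
  using assms(2,3)
proof (induction t rule: dec_induct)
  case base
  have "is_trend s s (\<lambda>_. 0)" by (simp add: is_trend_def)
  then show ?case by blast
next
  case (step n)
  then show ?case
    using is_trend_increment[of "Suc n"] is_trend_trans assms(1) by fastforce
qed

text \<open>Here conditioning on the whole path pays off: \<open>F > t\<close> is in general no
  function of \<open>D 1\<close> but it is one of the path, so it may enter the weight. On that
  event the outcomes observed at \<open>s\<close> and \<open>t\<close> are status-quo
  outcomes.\<close>

lemma trend_integral_observed:
  assumes h: "is_trend s t h" and "s \<le> t" and B: "B \<in> sets borel" "B \<subseteq> \<B>"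
  shows "(LINT \<omega>|M. indicator B (D 1 \<omega>) * indicator {t<..} (F \<omega>) * (Yo t \<omega> - Yo s \<omega>)) =
         (LINT \<omega>|M. indicator B (D 1 \<omega>) * indicator {t<..} (F \<omega>) * h (D 1 \<omega>))"
proof -
  let ?W = "\<lambda>\<omega>. indicator B (D 1 \<omega>) * indicator {t<..} (F \<omega>) :: real"
  have F: "F \<in> path_algebra \<rightarrow>\<^sub>M count_space UNIV"
    unfolding switch_date_def[abs_def]
    by (rule measurable_compose[OF path_path_measurable first_switch_measurable[OF T_pos]])
  have "D 1 \<in> borel_measurable path_algebra"
    using D1_path_measurable by simp
  then have "(\<lambda>\<omega>. indicator B (D 1 \<omega>) :: real) \<in> borel_measurable path_algebra"
    using B(1) by (intro measurable_compose[OF _ borel_measurable_indicator])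
  moreover have "(\<lambda>\<omega>. indicator {t<..} (F \<omega>) :: real) \<in> borel_measurable path_algebra"
    by (rule measurable_compose[OF F]) simp
  ultimately have W: "?W \<in> borel_measurable path_algebra"
    by (rule borel_measurable_times)
  have "(LINT \<omega>|M. ?W \<omega> * (Yo t \<omega> - Yo s \<omega>)) =
      (LINT \<omega>|M. ?W \<omega> * (indicator \<B> (D 1 \<omega>) * (Y0 t \<omega> - Y0 s \<omega>)))"
    using B(2) \<open>s \<le> t\<close>
    by (intro Bochner_Integration.integral_cong)
       (auto simp: observed_eq_status_quo split: split_indicator)
  also have "\<dots> = (LINT \<omega>|M. ?W \<omega> * h (D 1 \<omega>))"
    using h W unfolding is_trend_def by (auto simp: indicator_def)
  finally show ?thesis .
qed

text \<open>Agreement of \<open>\<Delta>\<close> with the trend functions is asked for on the effect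
  event, so the lemma serves both for a version of the conditional expectation and for the trend
  function of another model. The two integrands differ by a sum over \<open>f\<close> of weighted
  deviations of the status-quo trend from \<open>h f (D 1 \<omega>)\<close>, each of mean zero by
  \<open>is_trend\<close>.\<close>

lemma AVSQ_eq_contrast:
  assumes l: "1 \<le> l" and wd: "AVSQ_well_defined M T Y D \<kappa> l"
    and \<Delta>: "\<And>f. f \<in> {2..T + 1 - l} \<Longrightarrow> (\<lambda>d. \<Delta> d f) \<in> borel_measurable borel"
    and trend: "\<And>f. f \<in> {2..T + 1 - l} \<Longrightarrow> is_trend (f - 1) (f - 1 + l) (h f)"
    and agree: "\<And>f. f \<in> {2..T + 1 - l} \<Longrightarrow>
      AE \<omega> in M. \<omega> \<in> effect_event M T D \<kappa> l \<and> F \<omega> = f \<longrightarrow> \<Delta> (D 1 \<omega>) f = h f (D 1 \<omega>)"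
  shows "AVSQ M T Y D \<kappa> l = event_exp M (\<lambda>\<omega>. switch_sign T D \<omega> *
       (Yo (F \<omega> - 1 + l) \<omega> - Yo (F \<omega> - 1) \<omega> - \<Delta> (D 1 \<omega>) (F \<omega>))) (effect_event M T D \<kappa> l)"
proof -
  let ?J = "{2..T + 1 - l}" and ?A = "effect_event M T D \<kappa> l" and ?P = "effect_paths M T D \<kappa> l"
  \<comment> \<open>Sign, effect path and \<open>F = f\<close> together form a function of the path
    bounded by 1, which is an admissible weight for \<open>is_trend\<close>.\<close>
  define W where "W f \<omega> = indicator ?P (treatment_path T D \<omega>) *
      (indicator {f} (first_switch T (treatment_path T D \<omega>)) * path_sign T (treatment_path T D \<omega>))" for f \<omega>
  define X where "X f \<omega> = indicator \<B> (D 1 \<omega>) * (Y0 (f - 1 + l) \<omega> - Y0 (f - 1) \<omega>)" for f \<omega>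
  have "(\<lambda>d. indicator ?P d * (indicator {f} (first_switch T d) * path_sign T d))
      \<in> borel_measurable (seq_algebra T)" for f
    by (intro borel_measurable_times path_sign_measurable[OF T_pos] borel_measurable_indicator'
        measurable_compose[OF first_switch_measurable[OF T_pos]])
      (use effect_paths_measurable[OF l] in \<open>simp_all add: pred_def\<close>)
  then have W: "W f \<in> borel_measurable path_algebra" for f
    unfolding W_def by (rule measurable_compose[OF path_path_measurable])
  then have W_M: "W f \<in> borel_measurable M" for f
    by (rule measurable_from_subalg[OF subalgebra_path])
  have W_le: "\<bar>W f \<omega>\<bar> \<le> 1" for f \<omega>
    using abs_path_sign_le_1 by (auto simp: W_def indicator_def)
  have W_eq: "W f \<omega> = indicator ?A \<omega> * (indicator {f} (F \<omega>) * switch_sign T D \<omega>)" if "\<omega> \<in> space M" for f \<omega>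
    using that by (simp add: W_def effect_event_def switch_date_def switch_sign_path indicator_def)
  have int: "integrable M (\<lambda>\<omega>. W f \<omega> * X f \<omega>)" "integrable M (\<lambda>\<omega>. W f \<omega> * h f (D 1 \<omega>))"
    and eq: "(LINT \<omega>|M. W f \<omega> * X f \<omega>) = (LINT \<omega>|M. W f \<omega> * h f (D 1 \<omega>))"
    if "f \<in> ?J" for f
    using trend[OF that] W W_le
    by (auto simp: is_trend_def X_def intro!: integrable_bounded_mult[OF W_M W_le])
  have rest: "integrable M (\<lambda>\<omega>. \<Sum>f\<in>?J. W f \<omega> * X f \<omega> - W f \<omega> * h f (D 1 \<omega>))"
    by (intro Bochner_Integration.integrable_sum Bochner_Integration.integrable_diff int)
  have avsq: "integrable M (\<lambda>\<omega>. indicator ?A \<omega> * avsq_integrand T Y D l \<omega>)"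
    using wd by (simp add: AVSQ_well_defined_def set_integrable_def)
  \<comment> \<open>Add and subtract the status-quo outcome at \<open>F - 1 + l\<close>; at
    \<open>F - 1\<close> the observed outcome already is the status-quo one. In the sum only
    \<open>f = F\<close> survives.\<close>
  have decomp: "AE \<omega> in M. effect_contrast T l ?P \<Delta> (observables T Y D \<omega>) =
      indicator ?A \<omega> * avsq_integrand T Y D l \<omega> +
      (\<Sum>f\<in>?J. W f \<omega> * X f \<omega> - W f \<omega> * h f (D 1 \<omega>))"
  proof -
    have "AE \<omega> in M. \<forall>f\<in>?J. \<omega> \<in> ?A \<and> F \<omega> = f \<longrightarrow> \<Delta> (D 1 \<omega>) f = h f (D 1 \<omega>)"
      by (rule AE_finite_allI) (simp, erule agree)
    then show ?thesis
      using AE_space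
    proof eventually_elim
      case (elim \<omega>)
      show ?case
      proof (cases "\<omega> \<in> ?A")
        case True
        then have F: "F \<omega> \<in> ?J" and rel: "D 1 \<omega> \<in> \<B>"
          unfolding effect_event_iff[OF l] by blast+
        have "(\<Sum>f\<in>?J. W f \<omega> * X f \<omega> - W f \<omega> * h f (D 1 \<omega>)) =
            (\<Sum>f\<in>?J. if f = F \<omega> then switch_sign T D \<omega> * (X f \<omega> - h f (D 1 \<omega>)) else 0)"
          by (rule sum.cong[OF refl]) (use elim(2) True in \<open>auto simp: W_eq algebra_simps\<close>)
        also have "\<dots> = switch_sign T D \<omega> * (X (F \<omega>) \<omega> - h (F \<omega>) (D 1 \<omega>))"
          using F by simp
        finally show ?thesis
          using True rel F elim F_bounds(1)[of \<omega>] observed_eq_status_quo[of "F \<omega> - 1" \<omega>]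
          by (simp add: contrast_at_observables[OF l] X_def avsq_integrand_def algebra_simps)
      next
        case False
        then show ?thesis
          using elim(2) by (simp add: contrast_at_observables[OF l] W_eq)
      qed
    qed
  qed
  have "(LINT \<omega>|M. effect_contrast T l ?P \<Delta> (observables T Y D \<omega>)) =
      (LINT \<omega>|M. indicator ?A \<omega> * avsq_integrand T Y D l \<omega> +
        (\<Sum>f\<in>?J. W f \<omega> * X f \<omega> - W f \<omega> * h f (D 1 \<omega>)))"
    by (intro integral_cong_AE decomp borel_measurable_add borel_measurable_integrable[OF avsq]
        borel_measurable_integrable[OF rest]
        measurable_compose[OF observables_measurable effect_contrast_measurable[OF l \<Delta>]])
  also have "\<dots> = (LINT \<omega>|M. indicator ?A \<omega> * avsq_integrand T Y D l \<omega>) +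
      (LINT \<omega>|M. (\<Sum>f\<in>?J. W f \<omega> * X f \<omega> - W f \<omega> * h f (D 1 \<omega>)))"
    by (rule Bochner_Integration.integral_add[OF avsq rest])
  also have "(LINT \<omega>|M. (\<Sum>f\<in>?J. W f \<omega> * X f \<omega> - W f \<omega> * h f (D 1 \<omega>))) =
      (\<Sum>f\<in>?J. (LINT \<omega>|M. W f \<omega> * X f \<omega>) - (LINT \<omega>|M. W f \<omega> * h f (D 1 \<omega>)))"
    by (subst Bochner_Integration.integral_sum)
      (intro sum.cong refl Bochner_Integration.integral_diff Bochner_Integration.integrable_diff int,
        assumption+)+
  also have "\<dots> = 0"
    by (rule sum.neutral) (use eq in auto)
  finally show ?thesis
    unfolding event_exp_contrast[OF l] unfolding AVSQ_def event_exp_def set_lebesgue_integral_def by simp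
qed

section \<open>Uniqueness of the trend function on groups that have not switched\<close>

lemma AE_le_if_integrals_eq:
  fixes u v :: "real \<Rightarrow> real"
  assumes u: "u \<in> borel_measurable borel" "integrable M (\<lambda>\<omega>. u (D 1 \<omega>))"
    and v: "v \<in> borel_measurable borel" "integrable M (\<lambda>\<omega>. v (D 1 \<omega>))"
    and eq: "\<And>B. B \<in> sets borel \<Longrightarrow> B \<subseteq> \<B> \<Longrightarrow>
      (LINT \<omega>|M. indicator B (D 1 \<omega>) * indicator {t<..} (F \<omega>) * u (D 1 \<omega>)) =
      (LINT \<omega>|M. indicator B (D 1 \<omega>) * indicator {t<..} (F \<omega>) * v (D 1 \<omega>))"
  shows "AE \<omega> in M. D 1 \<omega> \<in> \<B> \<and> F \<omega> > t \<longrightarrow> u (D 1 \<omega>) \<le> v (D 1 \<omega>)"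
proof -
  \<comment> \<open>As \<open>u\<close> and \<open>v\<close> are functions of \<open>D 1\<close>,
    the set where \<open>u > v\<close> is itself an admissible test set; over it the difference of
    the two integrals has a nonnegative integrand.\<close>
  define B where "B = \<B> \<inter> {d. u d > v d}"
  have "{d \<in> space borel. v d < u d} \<in> sets borel"
    by (rule borel_measurable_less[OF v(1) u(1)])
  then have B: "B \<in> sets borel" "B \<subseteq> \<B>"
    using relevant_measurable by (auto simp: B_def)
  let ?W = "\<lambda>\<omega>. indicator B (D 1 \<omega>) * indicator {t<..} (F \<omega>) :: real"
  define w where "w \<omega> = ?W \<omega> * (u (D 1 \<omega>) - v (D 1 \<omega>))" for \<omega>
  have W: "?W \<in> borel_measurable M"
    by (intro borel_measurable_times measurable_compose[OF D1_measurable(1)]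
        measurable_compose[OF F_measurable] borel_measurable_indicator B(1)) simp
  have int: "integrable M (\<lambda>\<omega>. ?W \<omega> * Z \<omega>)" if "integrable M Z" for Z
    by (rule integrable_bounded_mult[OF W _ that]) (simp add: indicator_def)
  have "(LINT \<omega>|M. indicator {\<omega>. w \<omega> > 0} \<omega> * w \<omega>) = (LINT \<omega>|M. w \<omega>)"
    by (intro Bochner_Integration.integral_cong) (auto simp: w_def B_def indicator_def)
  also have "\<dots> = (LINT \<omega>|M. ?W \<omega> * u (D 1 \<omega>)) - (LINT \<omega>|M. ?W \<omega> * v (D 1 \<omega>))"
    unfolding w_def right_diff_distrib
    by (rule Bochner_Integration.integral_diff[OF int[OF u(2)] int[OF v(2)]])
  also have "\<dots> = 0"
    using eq[OF B] by simp
  finally have "AE \<omega> in M. w \<omega> \<le> 0"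
    unfolding w_def
    by (intro AE_nonpos_if_integral_positive_part_eq_0 int Bochner_Integration.integrable_diff u v)
  then show ?thesis
  proof eventually_elim
    case (elim \<omega>)
    show ?case
    proof (intro impI leI notI)
      assume "D 1 \<omega> \<in> \<B> \<and> t < F \<omega>" "v (D 1 \<omega>) < u (D 1 \<omega>)"
      then have "w \<omega> = u (D 1 \<omega>) - v (D 1 \<omega>)"
        by (simp add: w_def B_def)
      with elim \<open>v (D 1 \<omega>) < u (D 1 \<omega>)\<close> show False by simp
    qed
  qed
qed

lemma AE_eq_if_integrals_eq:
  fixes u v :: "real \<Rightarrow> real"
  assumes "u \<in> borel_measurable borel" "integrable M (\<lambda>\<omega>. u (D 1 \<omega>))"
    and "v \<in> borel_measurable borel" "integrable M (\<lambda>\<omega>. v (D 1 \<omega>))"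
    and eq: "\<And>B. B \<in> sets borel \<Longrightarrow> B \<subseteq> \<B> \<Longrightarrow>
      (LINT \<omega>|M. indicator B (D 1 \<omega>) * indicator {t<..} (F \<omega>) * u (D 1 \<omega>)) =
      (LINT \<omega>|M. indicator B (D 1 \<omega>) * indicator {t<..} (F \<omega>) * v (D 1 \<omega>))"
  shows "AE \<omega> in M. D 1 \<omega> \<in> \<B> \<and> F \<omega> > t \<longrightarrow> u (D 1 \<omega>) = v (D 1 \<omega>)"
proof -
  have "AE \<omega> in M. D 1 \<omega> \<in> \<B> \<and> F \<omega> > t \<longrightarrow> u (D 1 \<omega>) \<le> v (D 1 \<omega>)"
    by (rule AE_le_if_integrals_eq[OF assms(1-4)]) (rule eq)
  moreover have "AE \<omega> in M. D 1 \<omega> \<in> \<B> \<and> F \<omega> > t \<longrightarrow> v (D 1 \<omega>) \<le> u (D 1 \<omega>)"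
    by (rule AE_le_if_integrals_eq[OF assms(3,4,1,2)]) (rule eq[symmetric])
  ultimately show ?thesis
    by eventually_elim auto
qed

text \<open>Passing to the conditional probability given \<open>F > t\<close> multiplies by the
  density \<open>indicator ?E \<omega> / prob ?E\<close>, so testing against events of the baseline
  algebra reduces to \<open>trend_integral_observed\<close>. If the event has probability zero, the
  claim is vacuous.\<close>

lemma status_quo_trend_agrees:
  assumes h: "is_trend s t h" and st: "1 \<le> s" "s \<le> t" "t \<le> T"
    and u: "cond_exp_version (uniform_measure M {\<omega> \<in> space M. F \<omega> > t})
      (\<lambda>\<omega>. Yo t \<omega> - Yo s \<omega>) (D 1) \<B> u"
  shows "AE \<omega> in M. D 1 \<omega> \<in> \<B> \<and> F \<omega> > t \<longrightarrow> u (D 1 \<omega>) = h (D 1 \<omega>)"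
proof (cases "prob {\<omega> \<in> space M. F \<omega> > t} = 0")
  case True
  then have "AE \<omega> in M. \<not> F \<omega> > t"
    by (subst (asm) prob_eq_0) auto
  then show ?thesis by eventually_elim simp
next
  case False
  let ?E = "{\<omega> \<in> space M. F \<omega> > t}" and ?R = "{\<omega> \<in> space M. D 1 \<omega> \<in> \<B>}"
  define U where "U = uniform_measure M ?E"
  define X where "X \<omega> = Yo t \<omega> - Yo s \<omega>" for \<omega>
  have E: "?E \<in> sets M" by measurable
  have E_pos: "emeasure M ?E \<noteq> 0" "emeasure M ?E < \<infinity>"
    using False by (auto simp: emeasure_eq_measure)
  interpret U: prob_space U
    unfolding U_def using E_pos by (intro prob_space_uniform_measure) auto
  have U_space: "space U = space M" and U_sets: "sets U = sets M"
    by (simp_all add: U_def)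
  have U_meas: "f \<in> borel_measurable U \<longleftrightarrow> f \<in> borel_measurable M" for f :: "'w \<Rightarrow> real"
    using measurable_cong_sets[OF U_sets refl, of "borel :: real measure"] by simp
  \<comment> \<open>A real density in place of the \<open>ennreal\<close> quotient, so that Bochner
    integrals over \<open>U\<close> can be rewritten over \<open>M\<close>.\<close>
  have U_density: "U = density M (\<lambda>\<omega>. ennreal (indicator ?E \<omega> / prob ?E))"
    unfolding U_def uniform_measure_def
    by (intro density_cong) (use False E in \<open>auto simp: emeasure_eq_measure indicator_def divide_ennreal zero_less_measure_iff ennreal_1[symmetric] simp del: ennreal_1\<close>)
  have dens: "(\<lambda>\<omega>. indicator ?E \<omega> / prob ?E) \<in> borel_measurable M"
      "AE \<omega> in M. 0 \<le> indicator ?E \<omega> / prob ?E"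
    using E by auto
  have sub: "subalgebra U baseline_algebra"
    using subalgebra_baseline by (simp add: subalgebra_def U_space U_sets)
  interpret S: sigma_finite_subalgebra U baseline_algebra
    by (intro finite_measure_subalgebra_is_sigma_finite finite_measure_subalgebra.intro
        finite_measure_subalgebra_axioms.intro sub U.finite_measure_axioms)
  have R: "?R \<in> sets baseline_algebra"
    using measurable_sets[OF D1_baseline_measurable(1) relevant_measurable]
    by (simp add: vimage_def Int_def conj_commute)
  have X: "X \<in> borel_measurable M"
    unfolding X_def using st by (intro borel_measurable_diff outcome_measurable) auto
  have R_ind: "(\<lambda>\<omega>. indicator ?R \<omega> :: real) \<in> borel_measurable M"
    using R subalgebra_baseline by (intro borel_measurable_indicator) (auto simp: subalgebra_def)
  have h_meas: "h \<in> borel_measurable borel" and h_int: "integrable M (\<lambda>\<omega>. h (D 1 \<omega>))"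
      and XY_int: "integrable M (\<lambda>\<omega>. indicator \<B> (D 1 \<omega>) * (Y0 t \<omega> - Y0 s \<omega>))"
    using h by (auto simp: is_trend_def)
  have int_U: "integrable U Z \<longleftrightarrow> integrable M (\<lambda>\<omega>. indicator ?E \<omega> / prob ?E * Z \<omega>)"
      "(LINT \<omega>|U. Z \<omega>) = (LINT \<omega>|M. indicator ?E \<omega> / prob ?E * Z \<omega>)"
    if "Z \<in> borel_measurable M" for Z :: "'w \<Rightarrow> real"
    unfolding U_density using integrable_density[OF that dens] integral_density[OF that dens]
    by simp_all
  have RX: "(\<lambda>\<omega>. indicator ?R \<omega> * X \<omega>) \<in> borel_measurable M"
    by (rule borel_measurable_times[OF R_ind X])
  have Rh: "(\<lambda>\<omega>. indicator ?R \<omega> * h (D 1 \<omega>)) \<in> borel_measurable M"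
    by (intro borel_measurable_times R_ind borel_measurable_integrable h_int)
  \<comment> \<open>Integrability of \<open>X\<close> is known only after cutting to
    \<open>?R\<close>, so the characterization is applied to the cut function; the indicator is
    taken out afterwards.\<close>
  have "AE \<omega> in U. real_cond_exp U baseline_algebra (\<lambda>\<omega>. indicator ?R \<omega> * X \<omega>) \<omega> =
      indicator ?R \<omega> * h (D 1 \<omega>)"
  proof (rule S.real_cond_exp_charact)
    have "integrable M (\<lambda>\<omega>. indicator ?E \<omega> / prob ?E * (indicator ?R \<omega> * X \<omega>)) \<longleftrightarrow>
        integrable M (\<lambda>\<omega>. indicator ?E \<omega> / prob ?E * (indicator \<B> (D 1 \<omega>) * (Y0 t \<omega> - Y0 s \<omega>)))"
      by (intro Bochner_Integration.integrable_cong)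
        (use st in \<open>auto simp: X_def observed_eq_status_quo indicator_def\<close>)
    moreover have "integrable M (\<lambda>\<omega>. indicator ?E \<omega> * (indicator \<B> (D 1 \<omega>) * (Y0 t \<omega> - Y0 s \<omega>)) / prob ?E)"
      by (intro integrable_divide_zero integrable_bounded_mult XY_int borel_measurable_indicator E)
        (simp add: indicator_def)
    ultimately show "integrable U (\<lambda>\<omega>. indicator ?R \<omega> * X \<omega>)"
      unfolding int_U(1)[OF RX] by simp
    have "integrable M (\<lambda>\<omega>. indicator ?E \<omega> * (indicator ?R \<omega> * h (D 1 \<omega>)) / prob ?E)"
      by (intro integrable_divide_zero integrable_bounded_mult h_int borel_measurable_indicator E R_ind)
        (simp_all add: indicator_def)
    then show "integrable U (\<lambda>\<omega>. indicator ?R \<omega> * h (D 1 \<omega>))"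
      unfolding int_U(1)[OF Rh] by simp
    show "(\<lambda>\<omega>. indicator ?R \<omega> * h (D 1 \<omega>)) \<in> borel_measurable baseline_algebra"
      by (intro borel_measurable_times borel_measurable_indicator R
          measurable_compose[OF D1_baseline_measurable(1) h_meas])
    fix A assume "A \<in> sets baseline_algebra"
    then obtain B where B: "B \<in> sets borel" "A = D 1 -` B \<inter> space M"
      by (auto simp: sets_vimage_algebra2)
    have A: "A \<in> sets M"
      using measurable_sets[OF D1_measurable(1) B(1)] B(2) by simp
    let ?B = "B \<inter> \<B>"
    have B': "?B \<in> sets borel" "?B \<subseteq> \<B>" using B(1) relevant_measurable by auto
    have A_ind: "(\<lambda>\<omega>. indicator A \<omega> * Z \<omega>) \<in> borel_measurable M"
      if "Z \<in> borel_measurable M" for Z :: "'w \<Rightarrow> real"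
      using A that by (intro borel_measurable_times borel_measurable_indicator)
    have "(LINT \<omega>:A|U. indicator ?R \<omega> * X \<omega>) =
        (LINT \<omega>|M. indicator ?B (D 1 \<omega>) * indicator {t<..} (F \<omega>) * (Yo t \<omega> - Yo s \<omega>)) / prob ?E"
      unfolding set_lebesgue_integral_def real_scaleR_def int_U(2)[OF A_ind[OF RX]]
        Bochner_Integration.integral_divide_zero[symmetric]
      by (intro Bochner_Integration.integral_cong) (auto simp: B(2) X_def indicator_def)
    also have "\<dots> = (LINT \<omega>|M. indicator ?B (D 1 \<omega>) * indicator {t<..} (F \<omega>) * h (D 1 \<omega>)) / prob ?E"
      using trend_integral_observed[OF h st(2) B'] by simp
    also have "\<dots> = (LINT \<omega>:A|U. indicator ?R \<omega> * h (D 1 \<omega>))"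
      unfolding set_lebesgue_integral_def real_scaleR_def int_U(2)[OF A_ind[OF Rh]]
        Bochner_Integration.integral_divide_zero[symmetric]
      by (intro Bochner_Integration.integral_cong) (auto simp: B(2) indicator_def)
    finally show "(LINT \<omega>:A|U. indicator ?R \<omega> * X \<omega>) = (LINT \<omega>:A|U. indicator ?R \<omega> * h (D 1 \<omega>))" .
  qed
  moreover have "AE \<omega> in U. real_cond_exp U baseline_algebra (\<lambda>\<omega>. indicator ?R \<omega> * X \<omega>) \<omega> =
      indicator ?R \<omega> * real_cond_exp U baseline_algebra X \<omega>"
    by (rule real_cond_exp_indicator_mult[OF S.sigma_finite_subalgebra_axioms R])
      (use X in \<open>simp add: U_meas\<close>)
  moreover have "AE \<omega> in U. D 1 \<omega> \<in> \<B> \<longrightarrow> real_cond_exp U baseline_algebra X \<omega> = u (D 1 \<omega>)"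
    using u[folded U_def X_def[abs_def]] unfolding cond_exp_version_def U_space by blast
  ultimately have "AE \<omega> in U. \<omega> \<in> space M \<longrightarrow> D 1 \<omega> \<in> \<B> \<longrightarrow> u (D 1 \<omega>) = h (D 1 \<omega>)"
    by eventually_elim (auto simp: indicator_def)
  then have "AE \<omega> in M. \<omega> \<in> ?E \<longrightarrow> \<omega> \<in> space M \<longrightarrow> D 1 \<omega> \<in> \<B> \<longrightarrow> u (D 1 \<omega>) = h (D 1 \<omega>)"
    unfolding U_def AE_uniform_measure[OF E_pos] .
  then show ?thesis
    using AE_space by eventually_elim auto
qed

end

section \<open>Identification\<close>

text \<open>\<open>1 \<le> T\<close> comes from a relevant baseline, whose kernel has nonempty
  support inside \<open>{2..T + 1}\<close>. Measurability of the path is part of the independence of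
  the group vectors.\<close>

lemma treatment_design_of_group_model:
  assumes panel: "panel_model M T Yfull Y D" and g: "g \<ge> 1" and group: "group_model M T (Y g) (D g) \<kappa>"
  shows "treatment_design M T (D g) \<kappa>"
proof -
  interpret prob_space M using panel by (simp add: panel_model_def)
  have kernel: "cond_dist_switch M T (D g) \<kappa>" and "relevant_baseline M (D g) \<kappa> \<noteq> {}"
    using group by (auto simp: group_model_def)
  then obtain d where "d \<in> rv_support M (D g 1)"
    by (auto simp: relevant_baseline_def)
  with kernel have "set_pmf (\<kappa> d) \<subseteq> {2..T + 1}"
    by (auto simp: cond_dist_switch_def)
  then have "1 \<le> T"
    using set_pmf_not_empty[of "\<kappa> d"] by fastforce
  moreover have "group_vector T (rv_support M (treatment_path T (D 1))) (Y g) (D g) \<in>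
      M \<rightarrow>\<^sub>M group_algebra T (rv_support M (treatment_path T (D 1)))"
    using panel g unfolding panel_model_def iid_groups_def indep_vars_def2 by auto
  then have "(\<lambda>\<omega>. snd (group_vector T (rv_support M (treatment_path T (D 1))) (Y g) (D g) \<omega>)) \<in>
      M \<rightarrow>\<^sub>M seq_algebra T"
    unfolding group_algebra_def by (rule measurable_snd')
  then have "treatment_path T (D g) \<in> M \<rightarrow>\<^sub>M seq_algebra T"
    by (simp add: group_vector_def)
  ultimately show ?thesis
    using kernel by unfold_locales
qed

lemma parallel_trends_design_of_group_model:
  assumes "panel_model M T Yfull Y D" "g \<ge> 1" "group_model M T (Y g) (D g) \<kappa>"
  shows "parallel_trends_design M T (D g) \<kappa> (Y g)"
proof -
  interpret treatment_design M T "D g" \<kappa>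
    by (rule treatment_design_of_group_model[OF assms])
  show ?thesis
    using assms(3) by unfold_locales (simp_all add: group_model_def)
qed

section \<open>Two models with the same law of the treatment path\<close>

locale equal_path_distributions =
  P: treatment_design M T D \<kappa> + Q: treatment_design M' T D' \<kappa>'
  for M :: "'w measure" and M' :: "'v measure" and T D D' \<kappa> \<kappa>' +
  assumes path_distr: "distr M (seq_algebra T) (treatment_path T D) =
      distr M' (seq_algebra T) (treatment_path T D')"
begin

lemma integral_path_eq:
  fixes g :: "treatment_seq \<Rightarrow> real"
  assumes "g \<in> borel_measurable (seq_algebra T)"
  shows "(LINT \<omega>|M. g (treatment_path T D \<omega>)) = (LINT \<omega>|M'. g (treatment_path T D' \<omega>))"
  using path_distr integral_distr[OF P.path_measurable assms] integral_distr[OF Q.path_measurable assms]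
  by simp

lemma path_support_eq: "rv_support M (treatment_path T D) = rv_support M' (treatment_path T D')"
proof (rule rv_support_cong_distr)
  have "distr M borel (treatment_path T D) =
      distr (distr M (seq_algebra T) (treatment_path T D)) borel (\<lambda>d. d)"
    by (subst distr_distr[OF seq_algebra_to_borel P.path_measurable]) (simp add: comp_def)
  also have "\<dots> = distr M' borel (treatment_path T D')"
    unfolding path_distr
    by (subst distr_distr[OF seq_algebra_to_borel Q.path_measurable]) (simp add: comp_def)
  finally show "distr M borel (treatment_path T D) = distr M' borel (treatment_path T D')" .
qed (rule P.path_borel_measurable Q.path_borel_measurable)+

lemma baseline_support_eq: "rv_support M (D 1) = rv_support M' (D' 1)"
proof (rule rv_support_cong_distr)
  have "distr M borel (D 1) =
      distr (distr M (seq_algebra T) (treatment_path T D)) borel (\<lambda>d. d 1)"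
    by (subst distr_distr[OF seq_algebra_component P.path_measurable]) (simp add: comp_def)
  also have "\<dots> = distr M' borel (D' 1)"
    unfolding path_distr
    by (subst distr_distr[OF seq_algebra_component Q.path_measurable]) (simp add: comp_def)
  finally show "distr M borel (D 1) = distr M' borel (D' 1)" .
qed (rule P.D1_measurable Q.D1_measurable)+

text \<open>Tested on events in \<open>D' 1\<close>, the defining property of a kernel is an
  identity between integrals of functions of the path. It can be moved to the first model, where
  \<open>kernel_integral\<close> gives it, and back.\<close>

lemma kernel_transfer: "cond_dist_switch M' T D' \<kappa>"
  unfolding cond_dist_switch_def cond_exp_version_def
proof (intro conjI allI ballI)
  fix d assume "d \<in> rv_support M' (D' 1)"
  then show "set_pmf (\<kappa> d) \<subseteq> {2..T + 1}"
    using P.set_kernel baseline_support_eq by simp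
next
  fix f
  show "(\<lambda>d. pmf (\<kappa> d) f) \<in> borel_measurable borel" by (rule P.kernel_measurable)
  let ?I = "indicator {\<omega> \<in> space M'. switch_date T D' \<omega> = f} :: 'v \<Rightarrow> real"
  have I: "{\<omega> \<in> space M'. switch_date T D' \<omega> = f} \<in> sets M'"
    using measurable_sets[OF Q.F_measurable, of "{f}"] by (simp add: vimage_def Int_def conj_commute)
  interpret S: sigma_finite_subalgebra M' Q.baseline_algebra by (rule Q.sigma_finite_baseline)
  have kernel_Q: "(\<lambda>\<omega>. pmf (\<kappa> (D' 1 \<omega>)) f) \<in> borel_measurable Q.baseline_algebra"
    by (rule measurable_compose[OF Q.D1_baseline_measurable(1) P.kernel_measurable])
  have "AE \<omega> in M'. real_cond_exp M' Q.baseline_algebra ?I \<omega> = pmf (\<kappa> (D' 1 \<omega>)) f"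
  proof (rule S.real_cond_exp_charact)
    show "integrable M' ?I"
      by (rule Q.integrable_const_bound[of _ 1]) (use I in \<open>auto simp: indicator_def\<close>)
    show "integrable M' (\<lambda>\<omega>. pmf (\<kappa> (D' 1 \<omega>)) f)"
      using measurable_from_subalg[OF Q.subalgebra_baseline kernel_Q]
      by (intro Q.integrable_const_bound[of _ 1]) (simp_all add: pmf_le_1)
    fix A assume "A \<in> sets Q.baseline_algebra"
    then obtain B where B: "B \<in> sets borel" "A = D' 1 -` B \<inter> space M'"
      by (auto simp: sets_vimage_algebra2)
    have B_ind: "(\<lambda>d. indicator B (d 1) :: real) \<in> borel_measurable (seq_algebra T)"
      by (rule measurable_compose[OF seq_algebra_component borel_measurable_indicator[OF B(1)]])
    have "(LINT \<omega>:A|M'. ?I \<omega>) =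
        (LINT \<omega>|M'. indicator B (treatment_path T D' \<omega> 1) *
          indicator {f} (first_switch T (treatment_path T D' \<omega>)))"
      unfolding set_lebesgue_integral_def
      by (intro Bochner_Integration.integral_cong) (auto simp: B(2) switch_date_def indicator_def)
    also have "\<dots> = (LINT \<omega>|M. indicator B (treatment_path T D \<omega> 1) *
          indicator {f} (first_switch T (treatment_path T D \<omega>)))"
      by (rule integral_path_eq[symmetric])
        (intro borel_measurable_times B_ind
          measurable_compose[OF first_switch_measurable[OF P.T_pos]], simp)
    also have "\<dots> = (LINT \<omega>|M. indicator B (D 1 \<omega>) *
        indicator {\<omega> \<in> space M. switch_date T D \<omega> = f} \<omega>)"
      by (intro Bochner_Integration.integral_cong) (auto simp: switch_date_def indicator_def)
    also have "\<dots> = (LINT \<omega>|M. indicator B (treatment_path T D \<omega> 1) * pmf (\<kappa> (treatment_path T D \<omega> 1)) f)"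
      unfolding P.kernel_integral[OF B(1), symmetric] by simp
    also have "\<dots> = (LINT \<omega>|M'. indicator B (treatment_path T D' \<omega> 1) * pmf (\<kappa> (treatment_path T D' \<omega> 1)) f)"
      by (rule integral_path_eq)
        (intro borel_measurable_times B_ind measurable_compose[OF seq_algebra_component P.kernel_measurable])
    also have "\<dots> = (LINT \<omega>:A|M'. pmf (\<kappa> (D' 1 \<omega>)) f)"
      unfolding set_lebesgue_integral_def
      by (intro Bochner_Integration.integral_cong) (auto simp: B(2) indicator_def)
    finally show "(LINT \<omega>:A|M'. ?I \<omega>) = (LINT \<omega>:A|M'. pmf (\<kappa> (D' 1 \<omega>)) f)" .
  qed (rule kernel_Q)
  then show "AE \<omega> in M'. D' 1 \<omega> \<in> UNIV \<longrightarrow> real_cond_exp M' Q.baseline_algebra ?I \<omega> = pmf (\<kappa> (D' 1 \<omega>)) f"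
    by eventually_elim simp
qed

text \<open>In the second model both kernels are versions of the same conditional probabilities; the
  exceptional sets of the countably many dates are united.\<close>

lemma AE_kernel_unique: "AE \<omega> in M'. \<kappa> (D' 1 \<omega>) = \<kappa>' (D' 1 \<omega>)"
proof -
  have "AE \<omega> in M'. \<forall>f. pmf (\<kappa> (D' 1 \<omega>)) f = pmf (\<kappa>' (D' 1 \<omega>)) f"
    unfolding AE_all_countable
  proof
    fix f
    have "AE \<omega> in M'. D' 1 \<omega> \<in> UNIV \<longrightarrow>
        real_cond_exp M' Q.baseline_algebra (indicator {\<omega> \<in> space M'. switch_date T D' \<omega> = f}) \<omega> =
        pmf (\<kappa>0 (D' 1 \<omega>)) f" if "cond_dist_switch M' T D' \<kappa>0" for \<kappa>0
      using that unfolding cond_dist_switch_def cond_exp_version_def by blast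
    from this[OF kernel_transfer] this[OF Q.switch_kernel]
    show "AE \<omega> in M'. pmf (\<kappa> (D' 1 \<omega>)) f = pmf (\<kappa>' (D' 1 \<omega>)) f"
      by eventually_elim simp
  qed
  then show ?thesis
    by eventually_elim (auto intro: pmf_eqI)
qed

lemma AE_effect_event_transfer:
  "AE \<omega> in M'. \<omega> \<in> effect_event M' T D' \<kappa> l \<longleftrightarrow> \<omega> \<in> effect_event M' T D' \<kappa>' l"
  using AE_kernel_unique
proof eventually_elim
  case (elim \<omega>)
  then have "D' 1 \<omega> \<in> relevant_baseline M' D' \<kappa> \<longleftrightarrow> D' 1 \<omega> \<in> relevant_baseline M' D' \<kappa>'"
    by (simp add: relevant_baseline_def cond_var_switch_def)
  moreover have "T_bar \<kappa> (D' 1 \<omega>) = T_bar \<kappa>' (D' 1 \<omega>)"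
    using elim by (simp add: T_bar_def)
  ultimately show ?case
    by (simp add: effect_event_def effect_paths_def)
qed

text \<open>The set over which parallel trends is imposed depends on the kernel, but exchanging
  \<open>\<kappa>'\<close> for \<open>\<kappa>\<close> changes it by a null set only. Afterwards
  both models can be studied with a single kernel.\<close>

lemma parallel_trends_transfer:
  assumes "parallel_trends_design M' T D' \<kappa>' Y'"
  shows "parallel_trends_design M' T D' \<kappa> Y'"
proof -
  interpret Y: parallel_trends_design M' T D' \<kappa>' Y' by fact
  interpret K: treatment_design M' T D' \<kappa>
    by (intro treatment_design.intro treatment_design_axioms.intro Q.prob_space_axioms
        Q.T_pos Q.path_measurable kernel_transfer)
  let ?R = "\<lambda>\<kappa>. {\<omega> \<in> space M'. D' 1 \<omega> \<in> relevant_baseline M' D' \<kappa>}"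
  have rel: "AE \<omega> in M'. D' 1 \<omega> \<in> relevant_baseline M' D' \<kappa> \<longleftrightarrow> D' 1 \<omega> \<in> relevant_baseline M' D' \<kappa>'"
    using AE_kernel_unique by eventually_elim (simp add: relevant_baseline_def cond_var_switch_def)
  have R: "?R \<kappa> \<in> sets M'" "?R \<kappa>' \<in> sets M'"
    using measurable_sets[OF Q.D1_measurable(1) K.relevant_measurable]
      measurable_sets[OF Q.D1_measurable(1) Q.relevant_measurable]
    by (simp_all add: vimage_def Int_def conj_commute)
  have "parallel_trends M' T Y' D' \<kappa>"
    unfolding parallel_trends_def Let_def
  proof (intro ballI conjI)
    fix t assume t: "t \<in> {2..T}"
    let ?X = "\<lambda>\<omega>. status_quo Y' D' t \<omega> - status_quo Y' D' (t - 1) \<omega>"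
    have X: "?X \<in> borel_measurable M'"
      using t by (intro borel_measurable_diff Y.outcome_measurable) auto
    have trend: "set_integrable M' (?R \<kappa>') ?X"
      "AE \<omega> in M'. D' 1 \<omega> \<in> relevant_baseline M' D' \<kappa>' \<longrightarrow>
         real_cond_exp M' Q.path_algebra ?X \<omega> = real_cond_exp M' Q.baseline_algebra ?X \<omega>"
      using Y.trends t by (auto simp: parallel_trends_def Let_def)
    show "set_integrable M' (?R \<kappa>) ?X"
      using trend(1) unfolding set_integrable_def
    proof (rule integrable_cong_AE_imp)
      show "(\<lambda>\<omega>. indicator (?R \<kappa>) \<omega> *\<^sub>R ?X \<omega>) \<in> borel_measurable M'"
        by (intro borel_measurable_scaleR borel_measurable_indicator R X)
      show "AE \<omega> in M'. indicator (?R \<kappa>') \<omega> *\<^sub>R ?X \<omega> = indicator (?R \<kappa>) \<omega> *\<^sub>R ?X \<omega>"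
        using rel by eventually_elim (simp add: indicator_def)
    qed
    show "AE \<omega> in M'. D' 1 \<omega> \<in> relevant_baseline M' D' \<kappa> \<longrightarrow>
         real_cond_exp M' Q.path_algebra ?X \<omega> = real_cond_exp M' Q.baseline_algebra ?X \<omega>"
      using trend(2) rel by eventually_elim simp
  qed
  then show ?thesis
    by (intro parallel_trends_design.intro K.treatment_design_axioms
        parallel_trends_design_axioms.intro Y.outcomes)
qed

text \<open>
  The kernels of two models need only agree almost everywhere, so the relevant baselines and the
  effect events may differ by null sets.
\<close>
lemma AVSQ_transfer:
  assumes Y': "parallel_trends_design M' T D' \<kappa>' Y'" and l: "1 \<le> l"
    and wd: "AVSQ_well_defined M' T Y' D' \<kappa>' l"
  shows "AVSQ_well_defined M' T Y' D' \<kappa> l" "AVSQ M' T Y' D' \<kappa> l = AVSQ M' T Y' D' \<kappa>' l"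
proof -
  interpret Y: parallel_trends_design M' T D' \<kappa> Y'
    by (rule parallel_trends_transfer[OF Y'])
  let ?A = "\<lambda>\<kappa>. effect_event M' T D' \<kappa> l" and ?f = "avsq_integrand T Y' D' l"
  have A: "?A \<kappa> \<in> sets M'" "?A \<kappa>' \<in> sets M'"
    by (rule Y.effect_event_measurable[OF l] Q.effect_event_measurable[OF l])+
  have f: "(\<lambda>\<omega>. indicator (?A \<kappa>) \<omega> * ?f \<omega>) \<in> borel_measurable M'"
      "(\<lambda>\<omega>. indicator (?A \<kappa>') \<omega> * ?f \<omega>) \<in> borel_measurable M'"
    using Y.effect_event_iff[OF l] Q.effect_event_iff[OF l]
    by (auto intro!: Y.avsq_integrand_measurable l A simp del: atLeastAtMost_iff)
  have eq: "AE \<omega> in M'. indicator (?A \<kappa>') \<omega> * ?f \<omega> = indicator (?A \<kappa>) \<omega> * ?f \<omega>"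
    using AE_effect_event_transfer[of l] by eventually_elim (simp add: indicator_def)
  show "AVSQ_well_defined M' T Y' D' \<kappa> l"
    using wd integrable_cong_AE_imp[OF _ f(1) eq]
    by (simp add: AVSQ_well_defined_def set_integrable_def)
  have "measure M' (?A \<kappa>) = measure M' (?A \<kappa>')"
    by (rule Q.finite_measure_eq_AE[OF AE_effect_event_transfer A])
  moreover have "(LINT \<omega>|M'. indicator (?A \<kappa>) \<omega> * ?f \<omega>) = (LINT \<omega>|M'. indicator (?A \<kappa>') \<omega> * ?f \<omega>)"
    using eq by (intro integral_cong_AE f) auto
  ultimately show "AVSQ M' T Y' D' \<kappa> l = AVSQ M' T Y' D' \<kappa>' l"
    by (simp add: AVSQ_def event_exp_def set_lebesgue_integral_def)
qed

end

text \<open>With the common kernel the effect paths of both models are equal as sets. The trend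
  function \<open>h\<close> of \<open>M\<close> is then used as \<open>\<Delta>\<close> in both: in
  \<open>M'\<close> it agrees on the effect event with the trend function \<open>k\<close>, because
  on groups that have not switched both integrate to the same observed trend. Hence both values are
  one functional of the law of the observables.\<close>

lemma AVSQ_identified:
  assumes M: "parallel_trends_design M T D \<kappa> Y" and M': "parallel_trends_design M' T D' \<kappa>' Y'"
    and obs: "observables_dist M' T Y' D' = observables_dist M T Y D"
    and l: "1 \<le> l"
    and wd: "AVSQ_well_defined M T Y D \<kappa> l" and wd': "AVSQ_well_defined M' T Y' D' \<kappa>' l"
  shows "AVSQ M' T Y' D' \<kappa>' l = AVSQ M T Y D \<kappa> l"
proof -
  interpret P: parallel_trends_design M T D \<kappa> Y by fact
  interpret Q': parallel_trends_design M' T D' \<kappa>' Y' by fact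
  have path: "distr N (seq_algebra T) (treatment_path T C) =
      distr (observables_dist N T V C) (seq_algebra T) snd"
    if "observables T V C \<in> N \<rightarrow>\<^sub>M P.Obs" for N :: "'x measure" and V C
    unfolding observables_dist_def distr_distr[OF measurable_snd that]
    by (simp add: comp_def observables_def)
  interpret equal_path_distributions M M' T D D' \<kappa> \<kappa>'
    by unfold_locales
      (simp only: path[OF P.observables_measurable] path[OF Q'.observables_measurable] obs)
  interpret Q: parallel_trends_design M' T D' \<kappa> Y'
    by (rule parallel_trends_transfer[OF M'])
  have rel: "relevant_baseline M' D' \<kappa> = relevant_baseline M D \<kappa>"
    by (simp only: relevant_baseline_def baseline_support_eq)
  have paths: "effect_paths M' T D' \<kappa> l = effect_paths M T D \<kappa> l"
    by (simp only: effect_paths_def no_crossing_paths_def rel path_support_eq)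
  have transport: "(LINT \<omega>|M. g (observables T Y D \<omega>)) = (LINT \<omega>|M'. g (observables T Y' D' \<omega>))"
    if "g \<in> borel_measurable P.Obs" for g :: "_ \<Rightarrow> real"
    using integral_distr[OF P.observables_measurable that]
      integral_distr[OF Q.observables_measurable that] obs
    by (simp add: observables_dist_def)
  let ?J = "{2..T + 1 - l}"
  have "\<exists>h. P.is_trend (f - 1) (f - 1 + l) h" "\<exists>h. Q.is_trend (f - 1) (f - 1 + l) h"
    if "f \<in> ?J" for f
    using that by (auto intro!: P.trend_exists Q.trend_exists)
  then obtain h k where h: "\<And>f. f \<in> ?J \<Longrightarrow> P.is_trend (f - 1) (f - 1 + l) (h f)"
      and k: "\<And>f. f \<in> ?J \<Longrightarrow> Q.is_trend (f - 1) (f - 1 + l) (k f)"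
    by metis
  have h_borel: "h f \<in> borel_measurable borel" and k_borel: "k f \<in> borel_measurable borel" if "f \<in> ?J" for f
    using h[OF that] k[OF that] by (simp_all add: P.is_trend_def Q.is_trend_def)
  have agree: "AE \<omega> in M'. \<omega> \<in> effect_event M' T D' \<kappa> l \<and> switch_date T D' \<omega> = f \<longrightarrow>
      h f (D' 1 \<omega>) = k f (D' 1 \<omega>)" if f: "f \<in> ?J" for f
  proof (rule Q.AE_effect_event_eq[OF l h_borel[OF f] k_borel[OF f]], rule Q.AE_eq_if_integrals_eq)
    let ?t = "f - 1 + l" and ?s = "f - 1"
    have st: "?s \<le> ?t" "?s \<in> {1..T}" "?t \<in> {1..T}" using f l by auto
    show "h f \<in> borel_measurable borel" "k f \<in> borel_measurable borel"
      by (rule h_borel[OF f] k_borel[OF f])+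
    show "integrable M' (\<lambda>\<omega>. k f (D' 1 \<omega>))"
      using k[OF f] by (simp add: Q.is_trend_def)
    have h1: "(\<lambda>d. h f (d 1)) \<in> borel_measurable (seq_algebra T)"
      by (rule measurable_compose[OF seq_algebra_component h_borel[OF f]])
    have "integrable M (\<lambda>\<omega>. h f (D 1 \<omega>))"
      using h[OF f] by (simp add: P.is_trend_def)
    then have "integrable (distr M (seq_algebra T) (treatment_path T D)) (\<lambda>d. h f (d 1))"
      by (subst integrable_distr_eq[OF P.path_measurable h1]) simp
    then have "integrable M' (\<lambda>\<omega>. h f (treatment_path T D' \<omega> 1))"
      unfolding path_distr by (subst (asm) integrable_distr_eq[OF Q.path_measurable h1])
    then show "integrable M' (\<lambda>\<omega>. h f (D' 1 \<omega>))" by simp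
    fix B :: "real set" assume B: "B \<in> sets borel" "B \<subseteq> relevant_baseline M' D' \<kappa>"
    define W :: "treatment_seq \<Rightarrow> real"
      where "W d = indicator B (d 1) * indicator {?t<..} (first_switch T d)" for d
    have W: "W \<in> borel_measurable (seq_algebra T)"
      unfolding W_def
      by (intro borel_measurable_times measurable_compose[OF seq_algebra_component]
          measurable_compose[OF first_switch_measurable[OF P.T_pos]] borel_measurable_indicator B(1)) simp
    have y: "(\<lambda>x. W (snd x) * (fst x ?t - fst x ?s)) \<in> borel_measurable P.Obs"
      by (intro borel_measurable_times borel_measurable_diff measurable_compose[OF measurable_snd W]
          measurable_compose[OF measurable_fst seq_algebra_component])
    \<comment> \<open>\<open>h\<close> is moved to \<open>M\<close> as a function of the path and
      there exchanged for the observed trend of groups with \<open>F > ?t\<close>; the observed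
      trends of the two models coincide by equality of the laws, and in \<open>M'\<close> the
      observed trend is exchanged for \<open>k\<close>.\<close>
    have "(LINT \<omega>|M'. indicator B (D' 1 \<omega>) * indicator {?t<..} (switch_date T D' \<omega>) * h f (D' 1 \<omega>)) =
        (LINT \<omega>|M'. W (treatment_path T D' \<omega>) * h f (treatment_path T D' \<omega> 1))"
      by (simp add: W_def switch_date_def)
    also have "\<dots> = (LINT \<omega>|M. W (treatment_path T D \<omega>) * h f (treatment_path T D \<omega> 1))"
      by (rule integral_path_eq[symmetric]) (rule borel_measurable_times[OF W h1])
    also have "\<dots> = (LINT \<omega>|M. indicator B (D 1 \<omega>) * indicator {?t<..} (switch_date T D \<omega>) * h f (D 1 \<omega>))"
      by (simp add: W_def switch_date_def)
    also have "\<dots> = (LINT \<omega>|M. indicator B (D 1 \<omega>) * indicator {?t<..} (switch_date T D \<omega>) *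
        (observed Y D ?t \<omega> - observed Y D ?s \<omega>))"
      by (rule P.trend_integral_observed[OF h[OF f] st(1) B(1), symmetric]) (use B(2) rel in simp)
    also have "\<dots> = (LINT \<omega>|M. W (snd (observables T Y D \<omega>)) *
        (fst (observables T Y D \<omega>) ?t - fst (observables T Y D \<omega>) ?s))"
      unfolding W_def observables_def fst_conv snd_conv restrict_apply'[OF st(2)] restrict_apply'[OF st(3)]
      by (simp add: switch_date_def)
    also have "\<dots> = (LINT \<omega>|M'. W (snd (observables T Y' D' \<omega>)) *
        (fst (observables T Y' D' \<omega>) ?t - fst (observables T Y' D' \<omega>) ?s))"
      by (rule transport[OF y])
    also have "\<dots> = (LINT \<omega>|M'. indicator B (D' 1 \<omega>) * indicator {?t<..} (switch_date T D' \<omega>) *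
        (observed Y' D' ?t \<omega> - observed Y' D' ?s \<omega>))"
      unfolding W_def observables_def fst_conv snd_conv restrict_apply'[OF st(2)] restrict_apply'[OF st(3)]
      by (simp add: switch_date_def)
    also have "\<dots> = (LINT \<omega>|M'. indicator B (D' 1 \<omega>) * indicator {?t<..} (switch_date T D' \<omega>) * k f (D' 1 \<omega>))"
      by (rule Q.trend_integral_observed[OF k[OF f] st(1) B])
    finally show "(LINT \<omega>|M'. indicator B (D' 1 \<omega>) * indicator {?t<..} (switch_date T D' \<omega>) * h f (D' 1 \<omega>)) =
        (LINT \<omega>|M'. indicator B (D' 1 \<omega>) * indicator {?t<..} (switch_date T D' \<omega>) * k f (D' 1 \<omega>))" .
  qed
  define \<Delta> where "\<Delta> d f = h f d" for d f
  have \<Delta>: "(\<lambda>d. \<Delta> d f) \<in> borel_measurable borel" if "f \<in> ?J" for f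
    using h_borel[OF that] by (simp add: \<Delta>_def)
  have "AVSQ M' T Y' D' \<kappa>' l = AVSQ M' T Y' D' \<kappa> l"
    by (rule AVSQ_transfer(2)[OF M' l wd', symmetric])
  also have "\<dots> = (LINT x|observables_dist M' T Y' D'. effect_contrast T l (effect_paths M' T D' \<kappa> l) \<Delta> x) /
      measure (observables_dist M' T Y' D') {x \<in> space Q.Obs. snd x \<in> effect_paths M' T D' \<kappa> l}"
    by (rule trans[OF Q.AVSQ_eq_contrast[OF l AVSQ_transfer(1)[OF M' l wd'] \<Delta> k]
          Q.event_exp_contrast_distr[OF l \<Delta>]]) (assumption | simp only: \<Delta>_def agree)+
  also have "\<dots> = (LINT x|observables_dist M T Y D. effect_contrast T l (effect_paths M T D \<kappa> l) \<Delta> x) /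
      measure (observables_dist M T Y D) {x \<in> space P.Obs. snd x \<in> effect_paths M T D \<kappa> l}"
    by (simp only: obs paths)
  also have "\<dots> = AVSQ M T Y D \<kappa> l"
    by (rule trans[OF P.AVSQ_eq_contrast[OF l wd \<Delta> h] P.event_exp_contrast_distr[OF l \<Delta>], symmetric])
      (assumption | simp add: \<Delta>_def)+
  finally show ?thesis .
qed

theorem theorem1:
  fixes M :: "'w measure"
    and T :: nat
    and Yfull Y :: "nat \<Rightarrow> nat \<Rightarrow> treatment_seq \<Rightarrow> 'w \<Rightarrow> real"
    and D :: "nat \<Rightarrow> nat \<Rightarrow> 'w \<Rightarrow> real"
    and \<kappa> :: "real \<Rightarrow> nat pmf"
    and g :: nat
  assumes "panel_model M T Yfull Y D"
    and "g \<ge> 1"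
    and "group_model M T (Y g) (D g) \<kappa>"
  shows
    "(\<forall>l\<in>{1..T - 1}.
        measure M (effect_event M T (D g) \<kappa> l) > 0 \<and>
        AVSQ_well_defined M T (Y g) (D g) \<kappa> l \<longrightarrow>
          (\<forall>(M' :: 'v measure) Yfull' Y' D' \<kappa>' g'.
             panel_model M' T Yfull' Y' D' \<and> g' \<ge> 1 \<and>
             group_model M' T (Y' g') (D' g') \<kappa>' \<and>
             AVSQ_well_defined M' T (Y' g') (D' g') \<kappa>' l \<and>
             observables_dist M' T (Y' g') (D' g') = observables_dist M T (Y g) (D g) \<longrightarrow>
             AVSQ M' T (Y' g') (D' g') \<kappa>' l = AVSQ M T (Y g) (D g) \<kappa> l) \<and>
          (\<forall>\<Delta>. status_quo_trend M T (Y g) (D g) \<kappa> l \<Delta> \<longrightarrow>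
             AVSQ M T (Y g) (D g) \<kappa> l =
             event_exp M
               (\<lambda>\<omega>. switch_sign T (D g) \<omega> *
                  (observed (Y g) (D g) (switch_date T (D g) \<omega> - 1 + l) \<omega> -
                   observed (Y g) (D g) (switch_date T (D g) \<omega> - 1) \<omega> -
                   \<Delta> (D g 1 \<omega>) (switch_date T (D g) \<omega>)))
               (effect_event M T (D g) \<kappa> l))) \<and>
     measure M (effect_event M T (D g) \<kappa> 1) > 0"
proof (intro conjI ballI impI allI)
  interpret parallel_trends_design M T "D g" \<kappa> "Y g"
    by (rule parallel_trends_design_of_group_model[OF assms])
  show "measure M (effect_event M T (D g) \<kappa> 1) > 0"
    using assms(3) by (intro prob_effect_event_1_pos) (auto simp: group_model_def)
  fix l
  assume "l \<in> {1..T - 1}" and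
    "measure M (effect_event M T (D g) \<kappa> l) > 0 \<and> AVSQ_well_defined M T (Y g) (D g) \<kappa> l"
  then have l: "1 \<le> l" and wd: "AVSQ_well_defined M T (Y g) (D g) \<kappa> l" by auto
  show "AVSQ M' T (Y' g') (D' g') \<kappa>' l = AVSQ M T (Y g) (D g) \<kappa> l"
    if "panel_model M' T Yfull' Y' D' \<and> g' \<ge> 1 \<and> group_model M' T (Y' g') (D' g') \<kappa>' \<and>
      AVSQ_well_defined M' T (Y' g') (D' g') \<kappa>' l \<and>
      observables_dist M' T (Y' g') (D' g') = observables_dist M T (Y g) (D g)"
    for M' :: "'v measure" and Yfull' Y' D' \<kappa>' g'
    using that l wd
    by (intro AVSQ_identified[OF parallel_trends_design_axioms parallel_trends_design_of_group_model]) auto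
  fix \<Delta>
  assume trend: "status_quo_trend M T (Y g) (D g) \<kappa> l \<Delta>"
  let ?J = "{2..T + 1 - l}"
  have version: "cond_exp_version (uniform_measure M {\<omega> \<in> space M. switch_date T (D g) \<omega> > f - 1 + l})
      (\<lambda>\<omega>. observed (Y g) (D g) (f - 1 + l) \<omega> - observed (Y g) (D g) (f - 1) \<omega>)
      (D g 1) (relevant_baseline M (D g) \<kappa>) (\<lambda>d. \<Delta> d f)" if "f \<in> ?J" for f
    using trend that unfolding status_quo_trend_def by auto
  have "\<exists>h. is_trend (f - 1) (f - 1 + l) h" if "f \<in> ?J" for f
    using that by (auto intro!: trend_exists)
  then obtain h where h: "\<And>f. f \<in> ?J \<Longrightarrow> is_trend (f - 1) (f - 1 + l) (h f)"
    by metis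
  have \<Delta>: "(\<lambda>d. \<Delta> d f) \<in> borel_measurable borel" if "f \<in> ?J" for f
    using version[OF that] by (simp add: cond_exp_version_def)
  show "AVSQ M T (Y g) (D g) \<kappa> l =
       event_exp M
         (\<lambda>\<omega>. switch_sign T (D g) \<omega> *
            (observed (Y g) (D g) (switch_date T (D g) \<omega> - 1 + l) \<omega> -
             observed (Y g) (D g) (switch_date T (D g) \<omega> - 1) \<omega> -
             \<Delta> (D g 1 \<omega>) (switch_date T (D g) \<omega>)))
         (effect_event M T (D g) \<kappa> l)"
  proof (rule AVSQ_eq_contrast[OF l wd \<Delta> h])
    fix f assume f: "f \<in> ?J"
    \<comment> \<open>The hypothesis on \<open>\<Delta>\<close> speaks only of groups with
      \<open>F > f - 1 + l\<close>, whereas agreement is required on the effect event with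
      \<open>F = f\<close>; \<open>AE_effect_event_eq\<close> bridges these disjoint events through
      the kernel.\<close>
    have "AE \<omega> in M. D g 1 \<omega> \<in> relevant_baseline M (D g) \<kappa> \<and> switch_date T (D g) \<omega> > f - 1 + l \<longrightarrow>
        \<Delta> (D g 1 \<omega>) f = h f (D g 1 \<omega>)"
      using f by (intro status_quo_trend_agrees[OF h[OF f] _ _ _ version[OF f]]) auto
    then show "AE \<omega> in M. \<omega> \<in> effect_event M T (D g) \<kappa> l \<and> switch_date T (D g) \<omega> = f \<longrightarrow>
        \<Delta> (D g 1 \<omega>) f = h f (D g 1 \<omega>)"
      using h[OF f] by (intro AE_effect_event_eq l \<Delta>[OF f]) (simp_all add: is_trend_def)
  qed
qed

end
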